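(* Let $n$ be a positive integer, $k$ a non-negative integer, and $q\in\mathbb{C}$ with $0<|q|<1$. Then $$(q)_\infty^n\prod_{1\le i<j\le n}\frac{(q^{k(j-i)})_\infty}{(q^{k(j-i+1)})_\infty}=\sum_{\mu\in\mathbb{Z}^n}(-1)^{|\mu|}q^{-kn(\mu)+3n(\mu')+|\mu|(k(n-1)+1)}$$ $$\cdot{\prod_{1\le i<j\le n}}^{k,1}\left\{\frac{(q^{1+k(j-i-1)+\mu_i-\mu_j})_\infty}{(q^{k(j-i+1)+\mu_i-\mu_j})_\infty}\frac{(q^{1+k(2n-1-i-j)+\mu_i+\mu_j})_\infty}{(q^{k(2n+1-i-j)+\mu_i+\mu_j})_\infty}\right\},$$ where for $k=0$ the product over $i<j$ on the left-hand side is also read as $1$.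
   Context: For $\mu\in\mathbb{Z}^n$: $|\mu|=\sum_i\mu_i$, $n(\mu)=\sum_{i=1}^n(i-1)\mu_i$, $n(\mu')=\sum_{i=1}^n\binom{\mu_i}{2}$ with $\binom{x}{2}=x(x-1)/2$ for all integers $x$. $(a)_\infty=\prod_{i\ge0}(1-aq^i)$. A ratio $(x)_\infty/(xq^N)_\infty$ with $N\ge0$ an integer is interpreted as the finite product $\prod_{r=0}^{N-1}(1-xq^r)$ (also when numerator and denominator both vanish). The symbol ${\prod}^{r,s} f$ (a product sign, with its usual index range, carrying the additional superscript $r,s$) means $s$ if $r=0$, and the ordinary product $\prod f$ if $r\ne0$. *)

theory Defs
  imports "HOL-Analysis.Analysis"
begin

definition qpoch_inf :: "complex \<Rightarrow> complex \<Rightarrow> complex"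
  where "qpoch_inf q a = (\<Prod>i. 1 - a * q ^ i)"

text \<open>The quotient \<open>(q^a)_\<infinity> / (q^b)_\<infinity>\<close>. For \<open>a \<le> b\<close>, i.e. \<open>(x)_\<infinity> / (x q^N)_\<infinity>\<close> with \<open>x = q^a\<close> and
  \<open>N = b - a \<ge> 0\<close>, it is read as a finite product; this matters when numerator and denominator
  both vanish.\<close>

definition qpoch_quot :: "complex \<Rightarrow> int \<Rightarrow> int \<Rightarrow> complex"
  where "qpoch_quot q a b =
    (if a \<le> b then \<Prod>r<nat (b - a). 1 - q powi a * q ^ r
     else qpoch_inf q (q powi a) / qpoch_inf q (q powi b))"

lemma qpoch_inf_split:
  assumes "norm q < 1"
  shows "qpoch_inf q x = (\<Prod>r<N. 1 - x * q ^ r) * qpoch_inf q (x * q ^ N)"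
proof -
  have "summable (\<lambda>i. norm (x * q ^ i))"
    using assms by (simp add: norm_mult norm_power summable_mult summable_geometric)
  then have "convergent_prod (\<lambda>i. 1 - x * q ^ i)"
    by (intro abs_convergent_prod_imp_convergent_prod summable_imp_abs_convergent_prod) simp
  from has_prod_ignore_initial_segment'[OF this, of N] show ?thesis
    by (simp add: qpoch_inf_def has_prod_iff power_add mult_ac)
qed

lemma qpoch_quot_eq:
  assumes "q \<noteq> 0" "norm q < 1" "qpoch_inf q (q powi b) \<noteq> 0"
  shows "qpoch_quot q a b = qpoch_inf q (q powi a) / qpoch_inf q (q powi b)"
proof (cases "a \<le> b")
  case True
  then have "q powi a * q ^ nat (b - a) = q powi b"
    using assms(1) by (simp flip: power_int_of_nat power_int_add)
  with True assms qpoch_inf_split[of q "q powi a" "nat (b - a)"] show ?thesis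
    by (simp add: qpoch_quot_def)
qed (simp add: qpoch_quot_def)

text \<open>The product over \<open>A\<close> with superscript \<open>r,s\<close>: it is \<open>s\<close> if \<open>r = 0\<close>, and the ordinary product
  otherwise.\<close>

definition prod_exc :: "nat \<Rightarrow> complex \<Rightarrow> ('a \<Rightarrow> complex) \<Rightarrow> 'a set \<Rightarrow> complex"
  where "prod_exc r s f A = (if r = 0 then s else prod f A)"

definition index_pairs :: "nat \<Rightarrow> (nat \<times> nat) set"
  where "index_pairs n = {(i, j). 1 \<le> i \<and> i < j \<and> j \<le> n}"

text \<open>Elements of \<open>\<int>\<^sup>n\<close>, as functions on \<open>{1..n}\<close> (with the value \<open>undefined\<close> elsewhere, so that
  each vector is represented exactly once).\<close>

definition int_vecs :: "nat \<Rightarrow> (nat \<Rightarrow> int) set"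
  where "int_vecs n = {1..n} \<rightarrow>\<^sub>E UNIV"

definition vsize :: "nat \<Rightarrow> (nat \<Rightarrow> int) \<Rightarrow> int"
  where "vsize n \<mu> = (\<Sum>i=1..n. \<mu> i)"

definition nstat :: "nat \<Rightarrow> (nat \<Rightarrow> int) \<Rightarrow> int"
  where "nstat n \<mu> = (\<Sum>i=1..n. (int i - 1) * \<mu> i)"

text \<open>The quantity written \<open>n(\<mu>')\<close>. The division by 2 is exact.\<close>

definition nstat_conj :: "nat \<Rightarrow> (nat \<Rightarrow> int) \<Rightarrow> int"
  where "nstat_conj n \<mu> = (\<Sum>i=1..n. \<mu> i * (\<mu> i - 1) div 2)"

end

theory Submission
  imports Defs
begin

text \<open>
  Put \<open>x = q\<^sup>v\<close>, \<open>u = x + 1/x\<close> and \<open>p = 1/q\<close>. After the shift \<open>v\<^sub>m = \<mu>\<^sub>i + k m\<close>, \<open>m = n - i\<close>, the summand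
  becomes a constant times \<open>\<Prod>\<^sub>m w(v\<^sub>m) x\<^sub>m\<^bsup>-m\<^esup>\<close> times an antisymmetric polynomial \<open>V\<close> in the \<open>u\<^sub>m\<close>, where
  \<open>w(v) = (-1)\<^sup>v q\<^bsup>v(3v-1)/2\<^esup>\<close> is the weight of the pentagonal number theorem. In one variable,
  \<open>\<Sum>\<^sub>v w(v) f(u)\<close> equals \<open>(q)\<^sub>\<infinity> L\<^sub>1[f]\<close>, where \<open>L\<^sub>a\<close> is the linear functional that sends the continuous
  \<open>q\<close>-Hermite polynomial \<open>H\<^sub>m\<close> in base \<open>p\<close> to \<open>a\<^sup>m\<close>; it satisfies \<open>L\<^sub>a[(1 - ax)(1 - a/x) f] = L\<^bsub>pa\<^esub>[f]\<close>. The factors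
  \<open>x\<^sub>m\<^bsup>-m\<^esup>\<close> can be traded for monic polynomials \<open>s\<^sub>m(u)\<close> of degree \<open>m\<close>, so the multiple sum is
  \<open>(q)\<^sub>\<infinity>\<^sup>n\<close> times the value at \<open>a = 1\<close> of \<open>K(a) = L\<^sub>a\<^bsup>\<otimes>n\<^esup>[\<Prod>\<^sub>m s\<^sub>m(u\<^sub>m) V]\<close>, a polynomial in \<open>a\<close>.

  On polynomials of bounded degree, \<open>L\<^sub>a\<close> is a finite quadrature with nodes \<open>y\<^sub>i = a p\<^sup>i + 1/(a p\<^sup>i)\<close> and
  weights of order \<open>a\<^bsup>-2i\<^esup>\<close>. Since \<open>V\<close> vanishes when two indices differ by less than \<open>k\<close>, and the \<open>s\<^sub>m\<close> may
  be replaced by any monic polynomials of degree \<open>m\<close>, for instance by ones vanishing at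
  \<open>y\<^sub>0, y\<^sub>k, \<dots>, y\<^bsub>k(m-1)\<^esub>\<close>, only the configuration \<open>(0, k, \<dots>, k(n-1))\<close> survives as \<open>a \<rightarrow> \<infinity>\<close>. Hence \<open>K\<close> has a
  finite limit at infinity, so it is constant and equal to that one explicit term.
\<close>

section \<open>A one-parameter functional and its quadrature\<close>

text \<open>The operator \<open>g(a) \<mapsto> a g(a) + (g(a) - g(p a)) / a\<close>, which is how
  multiplication by \<open>u\<close> acts after passing to the parameter \<open>a\<close>. The
  polynomial division is exact, since the numerator vanishes at 0.\<close>

definition hermite_step :: "complex \<Rightarrow> complex poly \<Rightarrow> complex poly"
  where "hermite_step p g = pCons 0 g + (g - pcompose g [:0, p:]) div [:0, 1:]"

lemma poly_hermite_step:
  "a * poly (hermite_step p g) a = a\<^sup>2 * poly g a + poly g a - poly g (p * a)"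
proof -
  have "poly (g - pcompose g [:0, p:]) 0 = 0"
    by (simp add: poly_pcompose)
  then have "[:0, 1:] dvd g - pcompose g [:0, p:]"
    using poly_eq_0_iff_dvd[of "g - pcompose g [:0, p:]" 0] by simp
  then have "[:0, 1:] * ((g - pcompose g [:0, p:]) div [:0, 1:]) = g - pcompose g [:0, p:]"
    by (rule dvd_mult_div_cancel)
  from arg_cong[OF this, of "\<lambda>h. poly h a"]
  show ?thesis
    by (simp add: hermite_step_def poly_pcompose algebra_simps power2_eq_square)
qed

lemma hermite_step_add: "hermite_step p (f + g) = hermite_step p f + hermite_step p g"
  by (simp add: hermite_step_def pcompose_add add_diff_add poly_div_add_left)

lemma hermite_step_smult: "hermite_step p (smult c g) = smult c (hermite_step p g)"
  by (simp add: hermite_step_def pcompose_smult smult_diff_right[symmetric] div_smult_left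
      smult_add_right)

text \<open>As a function of \<open>a\<close>, \<open>hermite_mean p f\<close> is \<open>L\<^sub>a[f]\<close>, with \<open>f\<close> a polynomial in \<open>u\<close>: multiplication by \<open>u\<close>
  turns into \<open>a\<^sup>m \<mapsto> a\<^bsup>m+1\<^esup> + (1 - p\<^sup>m) a\<^bsup>m-1\<^esup>\<close>, the three-term recurrence of the \<open>H\<^sub>m\<close>.\<close>

definition hermite_mean :: "complex \<Rightarrow> complex poly \<Rightarrow> complex poly"
  where "hermite_mean p f = fold_coeffs (\<lambda>c g. [:c:] + hermite_step p g) f 0"

lemma hermite_mean_0 [simp]: "hermite_mean p 0 = 0"
  by (simp add: hermite_mean_def)

lemma hermite_step_0 [simp]: "hermite_step p 0 = 0"
  by (simp add: hermite_step_def)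

lemma hermite_mean_pCons:
  "hermite_mean p (pCons c f) = [:c:] + hermite_step p (hermite_mean p f)"
proof (cases "c = 0 \<and> f = 0")
  case False
  then show ?thesis by (auto simp: hermite_mean_def)
qed auto

lemma hermite_mean_add: "hermite_mean p (f + g) = hermite_mean p f + hermite_mean p g"
proof (induction f g rule: poly_induct2)
  case (pCons a f b g)
  then show ?case
    by (simp add: hermite_mean_pCons hermite_step_add)
qed auto

lemma hermite_mean_smult: "hermite_mean p (smult c f) = smult c (hermite_mean p f)"
  by (induction f) (auto simp: hermite_mean_pCons hermite_step_smult smult_add_right)

lemma hermite_mean_const [simp]: "hermite_mean p [:c:] = [:c:]"
  by (simp add: hermite_mean_pCons)

lemma hermite_mean_linear_factor:
  assumes "a \<noteq> 0"
  shows "poly (hermite_mean p ([:-(a + 1/a), 1:] * f)) a = - (1/a) * poly (hermite_mean p f) (p * a)"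
proof -
  have "[:-(a + 1/a), 1:] * f = pCons 0 f + smult (-(a + 1/a)) f"
    by (simp add: mult_pCons_left)
  then have "poly (hermite_mean p ([:-(a + 1/a), 1:] * f)) a =
      poly (hermite_step p (hermite_mean p f)) a - (a + 1/a) * poly (hermite_mean p f) a"
    by (simp only: hermite_mean_add hermite_mean_smult hermite_mean_pCons) (simp add: algebra_simps)
  also have "a * \<dots> = - poly (hermite_mean p f) (p * a)"
    using poly_hermite_step[of a p "hermite_mean p f"] assms
    by (simp add: algebra_simps power2_eq_square)
  finally show ?thesis using assms by (simp add: field_simps)
qed

section \<open>Quadrature nodes and weights\<close>

definition node :: "complex \<Rightarrow> complex \<Rightarrow> nat \<Rightarrow> complex"
  where "node p a i = a * p ^ i + 1 / (a * p ^ i)"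

lemma node_Suc: "node p a (Suc i) = node p (p * a) i"
  by (simp add: node_def mult_ac)

text \<open>The recursion is read off from \<open>f = (u - y\<^sub>0) g + f(y\<^sub>0)\<close>: the
  rule of order \<open>d\<close> at \<open>p * a\<close> is applied to \<open>g\<close>, whose
  values at the remaining nodes are divided differences of \<open>f\<close>.\<close>

fun quad_weight :: "complex \<Rightarrow> nat \<Rightarrow> complex \<Rightarrow> nat \<Rightarrow> complex" where
  "quad_weight p 0 a i = 1"
| "quad_weight p (Suc d) a 0 =
     1 + (\<Sum>j\<le>d. quad_weight p d (p * a) j / (a * (node p a (Suc j) - node p a 0)))"
| "quad_weight p (Suc d) a (Suc i) =
     - quad_weight p d (p * a) i / (a * (node p a (Suc i) - node p a 0))"

text \<open>Synthetic division at the first node lowers the degree,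
  \<open>hermite_mean_linear_factor\<close> moves \<open>a\<close> to \<open>p * a\<close>, and the
  nodes belonging to \<open>p * a\<close> are the nodes of \<open>a\<close> without the
  first.\<close>

lemma hermite_mean_quadrature:
  assumes "p \<noteq> 0" "a \<noteq> 0" "degree f \<le> d" "inj_on (node p a) {..d}"
  shows "poly (hermite_mean p f) a = (\<Sum>i\<le>d. quad_weight p d a i * poly f (node p a i))"
  using assms(2-)
proof (induction d arbitrary: a f)
  case 0
  then obtain c where "f = [:c:]" by (metis degree_eq_zeroE le_zero_eq)
  then show ?case by simp
next
  case (Suc d)
  define y0 where "y0 = node p a 0"
  define g where "g = synthetic_div f y0"
  have f: "f = [:-y0, 1:] * g + [:poly f y0:]"
    unfolding g_def by (rule synthetic_div_correct'[symmetric])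
  have y0: "y0 = a + 1/a" by (simp add: y0_def node_def)
  have ne: "node p a (Suc i) - y0 \<noteq> 0" if "i \<le> d" for i
    using inj_onD[OF Suc.prems(3), of "Suc i" 0] that by (auto simp: y0_def)
  have g: "poly g (node p a (Suc i)) = (poly f (node p a (Suc i)) - poly f y0) / (node p a (Suc i) - y0)"
    if "i \<le> d" for i
  proof -
    have "poly f (node p a (Suc i)) = (node p a (Suc i) - y0) * poly g (node p a (Suc i)) + poly f y0"
      by (subst (1) f) (simp add: algebra_simps)
    then show ?thesis
      using ne[OF that] by (metis add_diff_cancel_right' nonzero_mult_div_cancel_left)
  qed
  have "inj_on (node p (p * a)) {..d}"
    using Suc.prems(3) by (auto simp: inj_on_def simp flip: node_Suc)
  moreover have "degree g \<le> d"
    using Suc.prems(2) by (simp add: g_def degree_synthetic_div)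
  ultimately have IH: "poly (hermite_mean p g) (p * a) =
      (\<Sum>i\<le>d. quad_weight p d (p * a) i * poly g (node p a (Suc i)))"
    using Suc.IH[of "p * a" g] Suc.prems(1) \<open>p \<noteq> 0\<close> by (simp add: node_Suc)
  have "poly (hermite_mean p f) a = poly f y0 - 1/a * poly (hermite_mean p g) (p * a)"
    apply (subst (1) f)
    apply (simp only: hermite_mean_add)
    using hermite_mean_linear_factor[OF Suc.prems(1), of p g]
    apply (simp only: y0 hermite_mean_const poly_add)
    apply simp
    done
  also have "\<dots> = poly f y0 - 1/a * (\<Sum>i\<le>d. quad_weight p d (p * a) i *
      ((poly f (node p a (Suc i)) - poly f y0) / (node p a (Suc i) - y0)))"
    unfolding IH using g by simp
  \<comment> \<open>Collecting the coefficients of the values of \<open>f\<close> gives the two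
    recursive clauses of \<open>quad_weight\<close>; all the \<open>poly f y0\<close> parts join the
    weight of the node 0.\<close>
  also have "\<dots> = poly f y0 - (\<Sum>i\<le>d. quad_weight p d (p * a) i / (a * (node p a (Suc i) - y0)) *
      poly f (node p a (Suc i)) -
      quad_weight p d (p * a) i / (a * (node p a (Suc i) - y0)) * poly f y0)"
    by (simp add: sum_distrib_left diff_divide_distrib right_diff_distrib)
  also have "\<dots> = (\<Sum>i\<le>Suc d. quad_weight p (Suc d) a i * poly f (node p a i))"
    unfolding sum.atMost_Suc_shift
    by (simp add: y0_def[symmetric] sum_subtractf sum_negf algebra_simps sum_distrib_right
       sum_distrib_left)
  finally show ?case .
qed

section \<open>Asymptotics of nodes and weights as the parameter grows\<close>

lemma tendsto_const_divide_at_infinity: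
  "((\<lambda>a::complex. c / a) \<longlongrightarrow> 0) at_infinity"
  by (rule tendsto_divide_0[OF tendsto_const]) (simp add: filterlim_ident)

lemma eventually_nonzero_at_infinity: "eventually (\<lambda>a::complex. a \<noteq> 0) at_infinity"
  by (rule eventually_at_infinityI[of 1]) auto

lemma tendsto_node:
  assumes "p \<noteq> 0"
  shows "((\<lambda>a. node p a i / a) \<longlongrightarrow> p ^ i) at_infinity"
proof -
  have "((\<lambda>a. p ^ i + (1 / p ^ i / a) * (1 / a)) \<longlongrightarrow> p ^ i + 0 * 0) at_infinity"
    by (intro tendsto_intros tendsto_const_divide_at_infinity)
  then show ?thesis
    apply simp
    apply (erule Lim_transform_eventually)
    using eventually_nonzero_at_infinity
    apply eventually_elim
    apply (simp add: node_def assms field_simps)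
    done
qed

lemma power_inj_norm:
  assumes "norm (p::complex) > 1" "p ^ i = p ^ j"
  shows "i = j"
proof -
  have "norm p ^ i = norm p ^ j"
    using assms(2) by (metis norm_power)
  then show ?thesis using assms(1) by (simp add: power_inject_exp)
qed

text \<open>Divided by \<open>a\<close>, the nodes tend to the powers \<open>p ^ i\<close>, which
  are distinct because \<open>norm p > 1\<close>.\<close>

lemma eventually_inj_node:
  assumes "norm p > 1"
  shows "eventually (\<lambda>a. inj_on (node p a) {..d}) at_infinity"
proof -
  have p0: "p \<noteq> 0" using assms by auto
  have "eventually (\<lambda>a. i \<noteq> j \<longrightarrow> node p a i \<noteq> node p a j) at_infinity" for i j
  proof (cases "i = j")
    case False
    have "((\<lambda>a. node p a i / a - node p a j / a) \<longlongrightarrow> p ^ i - p ^ j) at_infinity"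
      by (intro tendsto_intros tendsto_node p0)
    moreover have "p ^ i - p ^ j \<noteq> 0" using power_inj_norm[OF assms] False by auto
    ultimately have "eventually (\<lambda>a. node p a i / a - node p a j / a \<noteq> 0) at_infinity"
      by (rule tendsto_imp_eventually_ne)
    then show ?thesis by (rule eventually_mono) auto
  qed auto
  then have "eventually (\<lambda>a. \<forall>i\<in>{..d}. \<forall>j\<in>{..d}. i \<noteq> j \<longrightarrow> node p a i \<noteq> node p a j) at_infinity"
    by (simp add: eventually_ball_finite_distrib)
  then show ?thesis by (rule eventually_mono) (auto simp: inj_on_def)
qed

text \<open>The leading coefficient of the \<open>i\<close>-th weight, which decays like
  \<open>a\<close> to the power \<open>-2 * i\<close>. It is the product of the factors met when
  unfolding the last clause of \<open>quad_weight\<close>.\<close>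

definition weight_limit :: "complex \<Rightarrow> nat \<Rightarrow> complex"
  where "weight_limit p i = (\<Prod>l<i. - 1 / (p ^ (2 * l) * (p ^ Suc l - 1)))"

lemma tendsto_quad_weight:
  assumes "norm p > 1" "i \<le> d"
  shows "((\<lambda>a. a ^ (2 * i) * quad_weight p d a i) \<longlongrightarrow> weight_limit p i) at_infinity"
  using assms(2)
proof (induction d arbitrary: i)
  case 0
  then show ?case by (simp add: weight_limit_def)
next
  case (Suc d)
  have p0: "p \<noteq> 0" using assms by auto
  have mult: "filterlim (\<lambda>a. p * a) at_infinity at_infinity"
    by (rule tendsto_mult_filterlim_at_infinity[OF tendsto_const p0 filterlim_ident])
  have IH: "((\<lambda>a. (p * a) ^ (2 * j) * quad_weight p d (p * a) j) \<longlongrightarrow> weight_limit p j) at_infinity"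
    if "j \<le> d" for j
    by (rule filterlim_compose[OF Suc.IH[OF that] mult])
  have N: "((\<lambda>a. 1 / (node p a (Suc j) / a - node p a 0 / a)) \<longlongrightarrow> 1 / (p ^ Suc j - p ^ 0)) at_infinity"
    for j
  proof -
    have "p ^ Suc j - p ^ 0 \<noteq> 0" using power_inj_norm[OF assms(1), of "Suc j" 0] by auto
    then show ?thesis by (intro tendsto_intros tendsto_node p0)
  qed
  show ?case
  proof (cases i)
    case 0
    \<comment> \<open>Each summand of the correction is rewritten as a product of factors with known
      limits; the factor \<open>(1 / a) ^ 2\<close> sends it to 0 even when
      \<open>j = 0\<close>.\<close>
    have scale: "((p * a) ^ (2 * j) * x) * (1 / p / a) ^ (2 * j) * ((1 / a) ^ 2 * (1 / (y / a - z / a))) =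
        x / (a * (y - z))" if "a \<noteq> 0" for a x y z j
    proof -
      have "(p * a) ^ (2 * j) * (1 / p / a) ^ (2 * j) = 1"
        using that p0 by (simp flip: power_mult_distrib)
      moreover have "(1 / a) ^ 2 * (1 / (y / a - z / a)) = 1 / (a * (y - z))"
        using that by (simp add: power2_eq_square flip: diff_divide_distrib)
      ultimately show ?thesis by (metis (no_types, lifting) mult.assoc mult.commute mult_1 times_divide_eq_right)
    qed
    have "((\<lambda>a. 1 + (\<Sum>j\<le>d. ((p * a) ^ (2 * j) * quad_weight p d (p * a) j) * (1 / p / a) ^ (2 * j) *
        ((1 / a) ^ 2 * (1 / (node p a (Suc j) / a - node p a 0 / a))))) \<longlongrightarrow>
        1 + (\<Sum>j\<le>d. weight_limit p j * 0 ^ (2 * j) * (0 ^ 2 * (1 / (p ^ Suc j - p ^ 0))))) at_infinity"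
      by (intro tendsto_intros IH N tendsto_const_divide_at_infinity) auto
    then have "((\<lambda>a. quad_weight p (Suc d) a 0) \<longlongrightarrow> 1) at_infinity"
      apply simp
      apply (erule Lim_transform_eventually)
      using eventually_nonzero_at_infinity
      apply eventually_elim
      subgoal for a
        using scale[of a]
        apply simp
        done
      done
    then show ?thesis using 0 by (simp add: weight_limit_def)
  next
    case (Suc j)
    with Suc.prems have j: "j \<le> d" by simp
    have "((\<lambda>a. - (1 / p ^ (2 * j)) * ((p * a) ^ (2 * j) * quad_weight p d (p * a) j) *
        (1 / (node p a (Suc j) / a - node p a 0 / a))) \<longlongrightarrow>
        - (1 / p ^ (2 * j)) * weight_limit p j * (1 / (p ^ Suc j - p ^ 0))) at_infinity"
      by (intro tendsto_intros IH N j)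
    moreover have "- (1 / p ^ (2 * j)) * weight_limit p j * (1 / (p ^ Suc j - p ^ 0)) = weight_limit p i"
      by (simp add: Suc weight_limit_def)
    ultimately have "((\<lambda>a. - (1 / p ^ (2 * j)) * ((p * a) ^ (2 * j) * quad_weight p d (p * a) j) *
        (1 / (node p a (Suc j) / a - node p a 0 / a))) \<longlongrightarrow> weight_limit p i) at_infinity"
      by simp
    then show ?thesis
      apply (rule Lim_transform_eventually)
      using eventually_nonzero_at_infinity
      apply eventually_elim
      apply (simp add: p0 Suc power_mult_distrib power2_eq_square diff_divide_distrib[symmetric])
      done
  qed
qed

section \<open>Alternating sums\<close>

text \<open>Reindexing the sum by an adjacent transposition moves it from \<open>\<sigma>\<close> to
  the index of \<open>g\<close> and changes the sign of \<open>G\<close>. The factor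
  \<open>w\<close> is the same function in every position and is not affected.\<close>

lemma alternating_sum_swap:
  fixes w :: "'b \<Rightarrow> complex" and g :: "nat \<Rightarrow> 'b \<Rightarrow> complex"
  assumes anti: "\<And>\<sigma>. G (\<sigma> \<circ> Transposition.transpose i (Suc i)) = - G \<sigma>" and i: "Suc i < n"
  shows "(\<Sum>\<sigma>\<in>{..<n} \<rightarrow>\<^sub>E A. (\<Prod>m<n. w (\<sigma> m) * g m (\<sigma> m)) * G \<sigma>) =
    - (\<Sum>\<sigma>\<in>{..<n} \<rightarrow>\<^sub>E A. (\<Prod>m<n. w (\<sigma> m) * g (Transposition.transpose i (Suc i) m) (\<sigma> m)) * (G \<sigma> :: complex))"
proof -
  let ?t = "Transposition.transpose i (Suc i)"
  have t: "?t ` {..<n} = {..<n}" using i by (intro transpose_image_eq) auto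
  have mem: "\<sigma> \<circ> ?t \<in> {..<n} \<rightarrow>\<^sub>E A" if "\<sigma> \<in> {..<n} \<rightarrow>\<^sub>E A" for \<sigma>
    using that i by (auto simp: PiE_iff extensional_def Transposition.transpose_def)
  have "(\<Sum>\<sigma>\<in>{..<n} \<rightarrow>\<^sub>E A. (\<Prod>m<n. w (\<sigma> m) * g m (\<sigma> m)) * G \<sigma>) =
    (\<Sum>\<sigma>\<in>{..<n} \<rightarrow>\<^sub>E A. (\<Prod>m<n. w ((\<sigma> \<circ> ?t) m) * g m ((\<sigma> \<circ> ?t) m)) * G (\<sigma> \<circ> ?t))"
    by (rule sum.reindex_bij_witness[of _ "\<lambda>\<sigma>. \<sigma> \<circ> ?t" "\<lambda>\<sigma>. \<sigma> \<circ> ?t"])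
      (auto simp: mem o_assoc[symmetric] simp del: PiE_iff)
  also have "\<dots> = (\<Sum>\<sigma>\<in>{..<n} \<rightarrow>\<^sub>E A. - ((\<Prod>m<n. w (\<sigma> m) * g (?t m) (\<sigma> m)) * G \<sigma>))"
  proof (intro sum.cong refl)
    fix \<sigma>
    have "(\<Prod>m<n. w ((\<sigma> \<circ> ?t) m) * g m ((\<sigma> \<circ> ?t) m)) = (\<Prod>m<n. w (\<sigma> m) * g (?t m) (\<sigma> m))"
      by (rule prod.reindex_bij_witness[of _ ?t ?t]) (use t in auto)
    then show "(\<Prod>m<n. w ((\<sigma> \<circ> ?t) m) * g m ((\<sigma> \<circ> ?t) m)) * G (\<sigma> \<circ> ?t) =
        - ((\<Prod>m<n. w (\<sigma> m) * g (?t m) (\<sigma> m)) * G \<sigma>)"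
      by (simp add: anti)
  qed
  finally show ?thesis by (simp add: sum_negf)
qed

text \<open>If the equal factors are adjacent, a swap shows that the sum is its own negative.
  Otherwise adjacent swaps move position \<open>j\<close> down towards \<open>i\<close>, each
  costing only a sign.\<close>

lemma alternating_sum_eq_0:
  fixes w :: "'b \<Rightarrow> complex" and g :: "nat \<Rightarrow> 'b \<Rightarrow> complex"
  assumes anti: "\<And>\<sigma> i. Suc i < n \<Longrightarrow> G (\<sigma> \<circ> Transposition.transpose i (Suc i)) = - G \<sigma>"
    and "i < j" "j < n" "g i = g j"
  shows "(\<Sum>\<sigma>\<in>{..<n} \<rightarrow>\<^sub>E A. (\<Prod>m<n. w (\<sigma> m) * g m (\<sigma> m)) * (G \<sigma> :: complex)) = 0"
  using assms(2-)
proof (induction j arbitrary: g)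
  case (Suc j)
  let ?S = "\<lambda>g. \<Sum>\<sigma>\<in>{..<n} \<rightarrow>\<^sub>E A. (\<Prod>m<n. w (\<sigma> m) * g m (\<sigma> m)) * (G \<sigma> :: complex)"
  have swap: "?S g = - ?S (g \<circ> Transposition.transpose j (Suc j))"
    using alternating_sum_swap[of G j n w g A] anti Suc.prems by simp
  show ?case
  proof (cases "i = j")
    case True
    then have "g \<circ> Transposition.transpose j (Suc j) = g"
      using Suc.prems by (auto simp: fun_eq_iff Transposition.transpose_def)
    with swap show ?thesis by simp
  next
    case False
    then have "?S (g \<circ> Transposition.transpose j (Suc j)) = 0"
      using Suc.prems by (intro Suc.IH) (auto simp: Transposition.transpose_def)
    with swap show ?thesis by simp
  qed
qed simp

text \<open>By strong induction every value below \<open>m\<close> is already taken by a smaller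
  argument.\<close>

lemma inj_on_le_imp_id:
  fixes f :: "nat \<Rightarrow> nat"
  assumes "inj_on f {..<n}" "\<And>m. m < n \<Longrightarrow> f m \<le> m" "m < n"
  shows "f m = m"
  using assms(3)
proof (induction m rule: less_induct)
  case (less m)
  show ?case
  proof (rule ccontr)
    assume "f m \<noteq> m"
    with assms(2)[OF less.prems] have lt: "f m < m" by simp
    with less have "f (f m) = f m" by simp
    with lt less.prems have "f m = m" using inj_onD[OF assms(1), of "f m" m] by simp
    with lt show False by simp
  qed
qed

text \<open>Expanding all \<open>P m\<close> into monomials gives exponent functions
  \<open>f\<close> with \<open>f m \<le> m\<close>. Non-injective ones contribute 0 by antisymmetry,
  and the only injective one is the identity, whose coefficient is 1. Hence one family of monic
  polynomials may be exchanged for another.\<close>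

lemma alternating_sum_monic:
  fixes w :: "'b \<Rightarrow> complex" and y :: "'b \<Rightarrow> complex"
  assumes anti: "\<And>\<sigma> i. Suc i < n \<Longrightarrow> G (\<sigma> \<circ> Transposition.transpose i (Suc i)) = - G \<sigma>"
    and P: "\<And>m. m < n \<Longrightarrow> degree (P m) = m" "\<And>m. m < n \<Longrightarrow> coeff (P m) m = 1"
  shows "(\<Sum>\<sigma>\<in>{..<n} \<rightarrow>\<^sub>E A. (\<Prod>m<n. w (\<sigma> m) * poly (P m) (y (\<sigma> m))) * (G \<sigma> :: complex)) =
    (\<Sum>\<sigma>\<in>{..<n} \<rightarrow>\<^sub>E A. (\<Prod>m<n. w (\<sigma> m) * y (\<sigma> m) ^ m) * G \<sigma>)"
proof -
  let ?F = "PiE {..<n} (\<lambda>m. {..m})"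
  let ?S = "\<lambda>f. \<Sum>\<sigma>\<in>{..<n} \<rightarrow>\<^sub>E A. (\<Prod>m<n. w (\<sigma> m) * y (\<sigma> m) ^ f m) * (G \<sigma> :: complex)"
  let ?id = "restrict (\<lambda>m. m) {..<n}"
  have fin: "finite ?F" by (intro finite_PiE) auto
  have "(\<Prod>m<n. w (\<sigma> m) * poly (P m) (y (\<sigma> m))) =
      (\<Sum>f\<in>?F. (\<Prod>m<n. coeff (P m) (f m)) * (\<Prod>m<n. w (\<sigma> m) * y (\<sigma> m) ^ f m))" for \<sigma>
  proof -
    have "(\<Prod>m<n. w (\<sigma> m) * poly (P m) (y (\<sigma> m))) =
      (\<Prod>m<n. \<Sum>l\<le>m. coeff (P m) l * (w (\<sigma> m) * y (\<sigma> m) ^ l))"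
      by (intro prod.cong) (auto simp: poly_altdef P sum_distrib_left mult_ac)
    also have "\<dots> = (\<Sum>f\<in>?F. \<Prod>m<n. coeff (P m) (f m) * (w (\<sigma> m) * y (\<sigma> m) ^ f m))"
      by (rule prod_sum_PiE) auto
    finally show ?thesis by (simp add: prod.distrib)
  qed
  then have "(\<Sum>\<sigma>\<in>{..<n} \<rightarrow>\<^sub>E A. (\<Prod>m<n. w (\<sigma> m) * poly (P m) (y (\<sigma> m))) * G \<sigma>) =
      (\<Sum>\<sigma>\<in>{..<n} \<rightarrow>\<^sub>E A. \<Sum>f\<in>?F. (\<Prod>m<n. coeff (P m) (f m)) *
        ((\<Prod>m<n. w (\<sigma> m) * y (\<sigma> m) ^ f m) * G \<sigma>))"
    by (simp only: sum_distrib_right mult.assoc)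
  also have "\<dots> = (\<Sum>f\<in>?F. (\<Prod>m<n. coeff (P m) (f m)) * ?S f)"
    by (subst sum.swap) (simp add: sum_distrib_left)
  also have "\<dots> = (\<Sum>f\<in>?F. if f = ?id then ?S ?id else 0)"
  proof (intro sum.cong refl)
    fix f assume f: "f \<in> ?F"
    show "(\<Prod>m<n. coeff (P m) (f m)) * ?S f = (if f = ?id then ?S ?id else 0)"
    proof (cases "inj_on f {..<n}")
      case True
      have "f m = m" if "m < n" for m
        using True that f by (intro inj_on_le_imp_id[of f n]) (auto simp: PiE_iff)
      moreover from this have "f = ?id"
        using f by (auto simp: PiE_iff extensional_def fun_eq_iff)
      ultimately have "(\<Prod>m<n. coeff (P m) (f m)) = 1" by (intro prod.neutral) (simp add: P(2))
      then show ?thesis using \<open>f = ?id\<close> by simp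
    next
      case False
      then obtain i j where "i < j" "j < n" "f i = f j"
        by (auto simp: inj_on_def) (metis linorder_neqE_nat)
      then have "?S f = 0"
        by (intro alternating_sum_eq_0[where g = "\<lambda>m x. y x ^ f m" and i = i and j = j]) (erule anti | simp)+
      moreover have "inj_on ?id {..<n}" by (simp add: inj_on_def)
      with False have "f \<noteq> ?id" by metis
      ultimately show ?thesis by simp
    qed
  qed
  also have "\<dots> = ?S ?id"
    using fin by (subst sum.delta) (auto simp: PiE_iff)
  also have "\<dots> = (\<Sum>\<sigma>\<in>{..<n} \<rightarrow>\<^sub>E A. (\<Prod>m<n. w (\<sigma> m) * y (\<sigma> m) ^ m) * G \<sigma>)"
    by (intro sum.cong refl arg_cong2[of _ _ _ _ "(*)"] prod.cong) auto
  finally show ?thesis .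
qed

section \<open>The interaction polynomial\<close>

text \<open>For \<open>w = z + 1/z\<close> the \<open>r\<close>-th quadratic factor is the product
  of \<open>u - q\<^sup>r z - 1/(q\<^sup>r z)\<close> and
  \<open>u - z/q\<^sup>r - q\<^sup>r/z\<close>, so it is a polynomial in \<open>u\<close> and
  \<open>w\<close> alone.\<close>

definition pair_factor :: "complex \<Rightarrow> nat \<Rightarrow> complex \<Rightarrow> complex \<Rightarrow> complex"
  where "pair_factor q k u w =
    (u - w) * (\<Prod>r=1..<k. u\<^sup>2 + w\<^sup>2 - (q ^ r + 1 / q ^ r) * u * w + (q ^ r - 1 / q ^ r)\<^sup>2)"

lemma pair_factor_commute: "pair_factor q k w u = - pair_factor q k u w"
  by (simp add: pair_factor_def algebra_simps)

text \<open>The multiple sum is expressed in \<open>q\<close>, the quadrature in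
  \<open>p = 1 / q\<close>; this symmetry lets both use the same interaction.\<close>

lemma pair_factor_inverse: "pair_factor (1 / q) k = pair_factor q k"
  by (intro ext) (simp add: pair_factor_def power_divide add.commute power2_commute)

text \<open>The linear factors with indices \<open>r\<close> and \<open>-r\<close> combine into one
  quadratic factor, and the index 0 gives \<open>u - w\<close>; each induction step adds the indices
  \<open>k\<close> and \<open>-k\<close>.\<close>

lemma pair_factor_prod:
  assumes "q \<noteq> 0" "x \<noteq> 0" "z \<noteq> 0" "k \<ge> 1"
  shows "pair_factor q k (x + 1/x) (z + 1/z) =
    (\<Prod>r\<in>{1 - int k..int k - 1}. x + 1/x - q powi r * z - 1 / (q powi r * z))"
  using assms(4)
proof (induction k rule: dec_induct)
  case base
  then show ?case by (simp add: pair_factor_def)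
next
  case (step k)
  let ?f = "\<lambda>r. x + 1/x - q powi r * z - 1 / (q powi r * z)"
  have set: "{1 - int (Suc k)..int (Suc k) - 1} = insert (int k) (insert (- int k) {1 - int k..int k - 1})"
    using step.hyps by auto
  have "?f (int k) * ?f (- int k) = (x + 1/x)\<^sup>2 + (z + 1/z)\<^sup>2 -
      (q ^ k + 1 / q ^ k) * (x + 1/x) * (z + 1/z) + (q ^ k - 1 / q ^ k)\<^sup>2"
  proof -
    define Q U where "Q = q ^ k" and "U = x + 1/x"
    have Q: "Q \<noteq> 0" using assms by (simp add: Q_def)
    have "(U - Q * z - 1 / (Q * z)) * (U - z / Q - Q / z) =
      U\<^sup>2 + (z + 1/z)\<^sup>2 - (Q + 1 / Q) * U * (z + 1/z) + (Q - 1 / Q)\<^sup>2"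
      using Q assms(3) by (simp add: field_simps power2_eq_square)
    then show ?thesis
      using assms by (simp add: Q_def U_def power_int_minus field_simps)
  qed
  moreover have "pair_factor q (Suc k) (x + 1/x) (z + 1/z) =
      pair_factor q k (x + 1/x) (z + 1/z) * ((x + 1/x)\<^sup>2 + (z + 1/z)\<^sup>2 -
      (q ^ k + 1 / q ^ k) * (x + 1/x) * (z + 1/z) + (q ^ k - 1 / q ^ k)\<^sup>2)"
    using step.hyps by (simp add: pair_factor_def prod.atLeastLessThan_Suc mult_ac)
  moreover have "(\<Prod>r\<in>{1 - int (Suc k)..int (Suc k) - 1}. ?f r) =
      ?f (int k) * ?f (- int k) * (\<Prod>r\<in>{1 - int k..int k - 1}. ?f r)"
    unfolding set using step.hyps by (subst prod.insert, simp, simp, subst prod.insert) auto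
  ultimately show ?case using step.IH by (simp only: mult_ac)
qed

lemma pair_factor_node_eq_0:
  assumes "p \<noteq> 0" "a \<noteq> 0" "i < j + k" "j < i + k"
  shows "pair_factor p k (node p a i) (node p a j) = 0"
proof -
  have k: "k \<ge> 1" using assms by simp
  have "p powi (int i - int j) * (a * p ^ j) = a * p ^ i"
    using assms by (simp add: power_int_diff)
  then have "a * p ^ i + 1 / (a * p ^ i) - p powi (int i - int j) * (a * p ^ j) -
      1 / (p powi (int i - int j) * (a * p ^ j)) = 0"
    by (simp only:) simp
  moreover have "int i - int j \<in> {1 - int k..int k - 1}" using assms by auto
  ultimately show ?thesis
    unfolding node_def using assms k
    by (subst pair_factor_prod) (auto intro: prod_zero)
qed

text \<open>The homogeneous part of top degree, \<open>2 * k - 1\<close>, of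
  \<open>pair_factor\<close>.\<close>

definition pair_lead :: "complex \<Rightarrow> nat \<Rightarrow> complex \<Rightarrow> complex \<Rightarrow> complex"
  where "pair_lead q k u w = (u - w) * (\<Prod>r=1..<k. (u - q ^ r * w) * (u - w / q ^ r))"

lemma tendsto_pair_factor:
  assumes "k \<ge> 1" "q \<noteq> 0" "((\<lambda>a. f a / a) \<longlongrightarrow> u) at_infinity" "((\<lambda>a. g a / a) \<longlongrightarrow> w) at_infinity"
  shows "((\<lambda>a. pair_factor q k (f a) (g a) / a ^ (2 * k - 1)) \<longlongrightarrow> pair_lead q k u w) at_infinity"
proof -
  have "((\<lambda>a. (f a / a - g a / a) * (\<Prod>r=1..<k. (f a / a)\<^sup>2 + (g a / a)\<^sup>2
        - (q ^ r + 1 / q ^ r) * (f a / a) * (g a / a) + (q ^ r - 1 / q ^ r)\<^sup>2 * (1 / a)\<^sup>2)) \<longlongrightarrow>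
      (u - w) * (\<Prod>r=1..<k. u\<^sup>2 + w\<^sup>2 - (q ^ r + 1 / q ^ r) * u * w + (q ^ r - 1 / q ^ r)\<^sup>2 * 0\<^sup>2))
      at_infinity"
    by (intro tendsto_intros assms tendsto_const_divide_at_infinity)
  moreover have "u\<^sup>2 + w\<^sup>2 - (q ^ r + 1 / q ^ r) * u * w + (q ^ r - 1 / q ^ r)\<^sup>2 * 0\<^sup>2 =
      (u - q ^ r * w) * (u - w / q ^ r)" for r
    using assms(2) by (simp add: field_simps power2_eq_square)
  ultimately have "((\<lambda>a. (f a / a - g a / a) * (\<Prod>r=1..<k. (f a / a)\<^sup>2 + (g a / a)\<^sup>2
        - (q ^ r + 1 / q ^ r) * (f a / a) * (g a / a) + (q ^ r - 1 / q ^ r)\<^sup>2 * (1 / a)\<^sup>2)) \<longlongrightarrow>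
        pair_lead q k u w) at_infinity"
    by (simp add: pair_lead_def)
  then show ?thesis
    apply (rule Lim_transform_eventually)
    using eventually_nonzero_at_infinity
  proof eventually_elim
    case (elim a)
    \<comment> \<open>One power of \<open>a\<close> goes to the linear factor and two to each of the
      \<open>k - 1\<close> quadratic factors.\<close>
    have "a ^ (2 * k - 1) = a * (\<Prod>r=1..<k. a\<^sup>2)"
      using \<open>k \<ge> 1\<close> by (simp flip: power_mult power_Suc) (rule arg_cong[of _ _ "(^) a"], simp)
    moreover have "(f a / a)\<^sup>2 + (g a / a)\<^sup>2
        - (q ^ r + 1 / q ^ r) * (f a / a) * (g a / a) + (q ^ r - 1 / q ^ r)\<^sup>2 * (1 / a)\<^sup>2 =
        ((f a)\<^sup>2 + (g a)\<^sup>2 - (q ^ r + 1 / q ^ r) * f a * g a + (q ^ r - 1 / q ^ r)\<^sup>2) / a\<^sup>2" for r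
      using elim by (simp add: power_divide add_divide_distrib diff_divide_distrib power2_eq_square)
    ultimately show ?case
      by (simp only: pair_factor_def prod_dividef flip: diff_divide_distrib) simp
  qed
qed

definition pair_prod :: "complex \<Rightarrow> nat \<Rightarrow> nat \<Rightarrow> (nat \<Rightarrow> complex) \<Rightarrow> complex"
  where "pair_prod q k n u = (\<Prod>m<n. \<Prod>l<m. pair_factor q k (u m) (u l))"

text \<open>An adjacent transposition permutes all ordered pairs \<open>l < m\<close> except
  \<open>(Suc i, i)\<close>, and the factor of that pair changes sign.\<close>

lemma pair_prod_transpose:
  assumes "Suc i < n"
  shows "pair_prod q k n (u \<circ> Transposition.transpose i (Suc i)) = - pair_prod q k n u"
proof -
  let ?t = "Transposition.transpose i (Suc i)"
  let ?P = "SIGMA m:{..<n}. {..<m}"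
  let ?Q = "?P - {(Suc i, i)}"
  have S: "pair_prod q k n v = pair_factor q k (v (Suc i)) (v i) *
      (\<Prod>(m, l)\<in>?Q. pair_factor q k (v m) (v l))" for v
  proof -
    have "pair_prod q k n v = (\<Prod>(m, l)\<in>?P. pair_factor q k (v m) (v l))"
      unfolding pair_prod_def by (rule prod.Sigma) auto
    also have "\<dots> = pair_factor q k (v (Suc i)) (v i) * (\<Prod>(m, l)\<in>?Q. pair_factor q k (v m) (v l))"
      using assms by (subst prod.remove[of _ "(Suc i, i)"]) auto
    finally show ?thesis .
  qed
  have mem: "(?t m, ?t l) \<in> ?Q" if "(m, l) \<in> ?Q" for m l
    using that assms by (auto simp: Transposition.transpose_def)
  have "(\<Prod>(m, l)\<in>?Q. pair_factor q k ((u \<circ> ?t) m) ((u \<circ> ?t) l)) =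
      (\<Prod>(m, l)\<in>?Q. pair_factor q k (u m) (u l))"
    by (rule prod.reindex_bij_witness[of _ "\<lambda>(m, l). (?t m, ?t l)" "\<lambda>(m, l). (?t m, ?t l)"])
      (use mem in auto)
  then show ?thesis
    unfolding S[of "u \<circ> ?t"] S[of u] using pair_factor_commute[of q k "u i" "u (Suc i)"]
    by simp
qed

section \<open>Polynomials in several variables as lists of monomials\<close>

text \<open>An explicit list of coefficients and exponents, so that a one-variable functional can be
  applied to each coordinate of each monomial.\<close>

definition monomial_sum :: "nat \<Rightarrow> (complex \<times> (nat \<Rightarrow> nat)) list \<Rightarrow> (nat \<Rightarrow> complex) \<Rightarrow> complex"
  where "monomial_sum n xs u = (\<Sum>(c, e)\<leftarrow>xs. c * (\<Prod>m<n. u m ^ e m))"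

definition polyfun :: "nat \<Rightarrow> ((nat \<Rightarrow> complex) \<Rightarrow> complex) \<Rightarrow> bool"
  where "polyfun n F \<longleftrightarrow> (\<exists>xs. \<forall>u. F u = monomial_sum n xs u)"

lemma monomial_sum_Nil [simp]: "monomial_sum n [] u = 0"
  by (simp add: monomial_sum_def)

lemma monomial_sum_Cons [simp]:
  "monomial_sum n (x # xs) u = fst x * (\<Prod>m<n. u m ^ snd x m) + monomial_sum n xs u"
  by (simp add: monomial_sum_def case_prod_unfold)

lemma monomial_sum_append [simp]:
  "monomial_sum n (xs @ ys) u = monomial_sum n xs u + monomial_sum n ys u"
  by (simp add: monomial_sum_def)

lemma polyfun_const: "polyfun n (\<lambda>_. c)"
  unfolding polyfun_def by (rule exI[of _ "[(c, \<lambda>_. 0)]"]) simp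

lemma polyfun_var: "m < n \<Longrightarrow> polyfun n (\<lambda>u. u m)"
  unfolding polyfun_def
  by (rule exI[of _ "[(1, \<lambda>i. if i = m then 1 else 0)]"])
    (simp add: if_distrib[of "power _"] prod.delta cong: if_cong)

lemma polyfun_add:
  assumes "polyfun n F" "polyfun n G"
  shows "polyfun n (\<lambda>u. F u + G u)"
  using assms unfolding polyfun_def by (metis monomial_sum_append)

lemma polyfun_mult:
  assumes "polyfun n F" "polyfun n G"
  shows "polyfun n (\<lambda>u. F u * G u)"
proof -
  from assms obtain xs ys where F: "\<And>u. F u = monomial_sum n xs u"
    and G: "\<And>u. G u = monomial_sum n ys u"
    unfolding polyfun_def by blast
  define mul where "mul x y = (fst x * fst y, \<lambda>m. snd x m + snd y m)"
    for x y :: "complex \<times> (nat \<Rightarrow> nat)"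
  have "monomial_sum n (map (mul x) ys) u = fst x * (\<Prod>m<n. u m ^ snd x m) * monomial_sum n ys u"
    for x ys u
    by (induction ys) (simp_all add: mul_def power_add prod.distrib distrib_left mult_ac)
  then have "monomial_sum n (concat (map (\<lambda>x. map (mul x) ys) xs)) u =
      monomial_sum n xs u * monomial_sum n ys u" for u
    by (induction xs) (simp_all add: distrib_right)
  then show ?thesis
    unfolding polyfun_def F G by metis
qed

lemma polyfun_diff:
  assumes "polyfun n F" "polyfun n G"
  shows "polyfun n (\<lambda>u. F u - G u)"
  using polyfun_add[OF assms(1) polyfun_mult[OF polyfun_const[of n "-1"] assms(2)]] by simp

lemma polyfun_prod:
  assumes "finite I" "\<And>i. i \<in> I \<Longrightarrow> polyfun n (F i)"
  shows "polyfun n (\<lambda>u. \<Prod>i\<in>I. F i u)"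
  using assms by (induction rule: finite_induct) (auto intro: polyfun_const polyfun_mult)

lemma polyfun_pair_prod: "polyfun n (pair_prod q k n)"
  unfolding pair_prod_def pair_factor_def power2_eq_square
  by (intro polyfun_prod polyfun_mult polyfun_diff polyfun_add polyfun_const polyfun_var) auto

section \<open>Minimal sums of separated indices\<close>

text \<open>The maximum of a set of \<open>c + 1\<close> natural numbers is at least
  \<open>c\<close>; removing it leaves the case of size \<open>c\<close>.\<close>

lemma sum_lessThan_card_le:
  "finite S \<Longrightarrow> (\<Sum>i<card S. i) \<le> \<Sum>(S :: nat set)"
proof (induction "card S" arbitrary: S)
  case (Suc c)
  then have ne: "S \<noteq> {}" by auto
  define M where "M = Max S"
  have M: "M \<in> S" using Suc ne by (simp add: M_def)
  have "S \<subseteq> {..M}" using Suc by (auto simp: M_def)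
  then have "card S \<le> Suc M" by (metis card_atMost card_mono finite_atMost)
  then have "c \<le> M" using Suc by simp
  moreover have "c = card (S - {M})" using Suc.hyps(2) Suc.prems M by simp
  ultimately have "(\<Sum>i<c. i) \<le> \<Sum>(S - {M})" using Suc.hyps(1)[of "S - {M}"] Suc.prems by simp
  with \<open>c \<le> M\<close> show ?case
    unfolding Suc.hyps(2)[symmetric] using sum.remove[OF Suc.prems M, of "\<lambda>x. x"] by simp
qed simp

lemma sum_lessThan_le_sum_inj:
  fixes f :: "nat \<Rightarrow> nat"
  assumes "inj_on f {..<n}"
  shows "(\<Sum>m<n. m) \<le> (\<Sum>m<n. f m)"
  using sum_lessThan_card_le[of "f ` {..<n}"] assms by (simp add: card_image sum.reindex)

text \<open>Indices at mutual distance at least \<open>k\<close> have distinct quotients by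
  \<open>k\<close>, whose sum is at least \<open>0 + ... + (n - 1)\<close>. In the case of equality
  all indices are multiples of \<open>k\<close>; excluding \<open>\<sigma> m = k * l\<close> for
  \<open>l < m\<close> makes the \<open>m\<close>-th quotient at least \<open>m\<close>, and
  equality of the sums makes it exactly \<open>m\<close>.\<close>

lemma spread_sum:
  fixes \<sigma> :: "nat \<Rightarrow> nat"
  assumes "k \<ge> 1" and gap: "\<And>l m. l < m \<Longrightarrow> m < n \<Longrightarrow> \<sigma> l + k \<le> \<sigma> m \<or> \<sigma> m + k \<le> \<sigma> l"
  shows "k * (\<Sum>m<n. m) \<le> (\<Sum>m<n. \<sigma> m)"
    and "\<lbrakk>(\<Sum>m<n. \<sigma> m) = k * (\<Sum>m<n. m); \<And>l m. l < m \<Longrightarrow> m < n \<Longrightarrow> \<sigma> m \<noteq> k * l; m < n\<rbrakk> \<Longrightarrow> \<sigma> m = k * m"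
proof -
  define \<tau> where "\<tau> m = \<sigma> m div k" for m
  have "\<tau> l \<noteq> \<tau> m" if lm: "l < m" "m < n" for l m
  proof -
    have "\<tau> l + 1 \<le> \<tau> m" if "\<sigma> l + k \<le> \<sigma> m"
      using div_le_mono[OF that, of k] assms(1) by (simp add: \<tau>_def)
    moreover have "\<tau> m + 1 \<le> \<tau> l" if "\<sigma> m + k \<le> \<sigma> l"
      using div_le_mono[OF that, of k] assms(1) by (simp add: \<tau>_def)
    ultimately show ?thesis using gap[OF lm] by linarith
  qed
  then have inj: "inj_on \<tau> {..<n}"
    by (auto simp: inj_on_def) (metis linorder_neqE_nat)
  have le: "k * \<tau> m \<le> \<sigma> m" for m by (simp add: \<tau>_def)
  have 1: "k * (\<Sum>m<n. m) \<le> k * (\<Sum>m<n. \<tau> m)"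
    using sum_lessThan_le_sum_inj[OF inj] by simp
  have 2: "k * (\<Sum>m<n. \<tau> m) \<le> (\<Sum>m<n. \<sigma> m)"
    unfolding sum_distrib_left by (intro sum_mono le)
  from 1 2 show "k * (\<Sum>m<n. m) \<le> (\<Sum>m<n. \<sigma> m)" by (rule order_trans)
  show "\<sigma> m = k * m" if eq: "(\<Sum>m<n. \<sigma> m) = k * (\<Sum>m<n. m)"
    and ne: "\<And>l m. l < m \<Longrightarrow> m < n \<Longrightarrow> \<sigma> m \<noteq> k * l" and m: "m < n"
  proof -
    \<comment> \<open>Subtraction of natural numbers is harmless here and below, because the
      difference is nonnegative termwise.\<close>
    have "(\<Sum>m<n. \<sigma> m - k * \<tau> m) = 0"
      using eq 1 2 le by (subst sum_subtractf_nat) (auto simp: sum_distrib_left)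
    then have \<sigma>: "\<sigma> m = k * \<tau> m" if "m < n" for m
      using that le[of m] by (simp add: sum_eq_0_iff order_antisym)
    have ge: "m \<le> \<tau> m" if "m < n" for m
      using ne[of "\<tau> m" m] \<sigma>[OF that] that by (meson not_le_imp_less)
    have "k * (\<Sum>m<n. \<tau> m) = k * (\<Sum>m<n. m)" using eq 1 2 by linarith
    then have "(\<Sum>m<n. \<tau> m - m) = 0"
      using ge assms(1) by (subst sum_subtractf_nat) auto
    then have "\<tau> m = m" using m ge[OF m] by (simp add: sum_eq_0_iff order_antisym)
    then show ?thesis using \<sigma>[OF m] by simp
  qed
qed

section \<open>Constancy in the parameter\<close>

definition spread_limit :: "complex \<Rightarrow> nat \<Rightarrow> nat \<Rightarrow> complex"
  where "spread_limit p k n =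
    (\<Prod>m<n. weight_limit p (k * m) * (\<Prod>l<m. p ^ (k * m) - p ^ (k * l))) *
    (\<Prod>m<n. \<Prod>l<m. pair_lead p k (p ^ (k * m)) (p ^ (k * l)))"

text \<open>Indices closer than \<open>k\<close> give 0 outright. Otherwise let \<open>S\<close> be
  the sum of all \<open>m < n\<close> and \<open>T\<close> that of the \<open>\<sigma> m\<close>.
  The weights have order \<open>-2 * T\<close> in \<open>a\<close>, the monic polynomials at most
  \<open>S\<close>, the pair factors at most \<open>(2 * k - 1) * S\<close>; in total at most
  \<open>2 * (k * S - T)\<close>, which \<open>spread_sum\<close> shows to be nonpositive. In the
  balanced case any configuration other than \<open>\<sigma> m = k * m\<close> hits a zero of the
  limiting monic product.\<close>

lemma tendsto_configuration:
  assumes p: "norm p > 1" and k: "k \<ge> 1" and le: "\<And>m. m < n \<Longrightarrow> \<sigma> m \<le> d"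
  shows "((\<lambda>a. (\<Prod>m<n. quad_weight p d a (\<sigma> m) * (\<Prod>l<m. node p a (\<sigma> m) - node p a (k * l))) *
      pair_prod p k n (\<lambda>m. node p a (\<sigma> m))) \<longlongrightarrow>
      (if \<forall>m<n. \<sigma> m = k * m then spread_limit p k n else 0)) at_infinity"
    (is "(?E \<longlongrightarrow> ?L) at_infinity")
proof (cases "\<forall>l m. l < m \<longrightarrow> m < n \<longrightarrow> \<sigma> l + k \<le> \<sigma> m \<or> \<sigma> m + k \<le> \<sigma> l")
  case False
  then obtain l m where lm: "l < m" "m < n" "\<sigma> l < \<sigma> m + k" "\<sigma> m < \<sigma> l + k"
    by (meson not_le)
  have L: "?L = 0"
  proof -
    have "\<not> (\<sigma> l = k * l \<and> \<sigma> m = k * m)"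
    proof
      assume "\<sigma> l = k * l \<and> \<sigma> m = k * m"
      with lm have "k * m < k * Suc l" by simp
      then have "m < Suc l" by (metis mult_less_cancel1)
      with lm show False by simp
    qed
    with lm show ?thesis by (meson less_trans)
  qed
  have "eventually (\<lambda>a. 0 = ?E a) at_infinity"
    using eventually_nonzero_at_infinity
  proof eventually_elim
    case (elim a)
    have "p \<noteq> 0" using p by auto
    then have "pair_factor p k (node p a (\<sigma> m)) (node p a (\<sigma> l)) = 0"
      using elim lm by (intro pair_factor_node_eq_0) auto
    then have "pair_prod p k n (\<lambda>m. node p a (\<sigma> m)) = 0"
      unfolding pair_prod_def using lm by (auto intro!: prod_zero)
    then show ?case by simp
  qed
  then show ?thesis
    unfolding L by (rule Lim_transform_eventually[OF tendsto_const])
next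
  case True
  then have gap: "\<And>l m. l < m \<Longrightarrow> m < n \<Longrightarrow> \<sigma> l + k \<le> \<sigma> m \<or> \<sigma> m + k \<le> \<sigma> l"
    by blast
  have p0: "p \<noteq> 0" using p by auto
  define S T where "S = (\<Sum>m<n. m)" and "T = (\<Sum>m<n. \<sigma> m)"
  have ST: "k * S \<le> T" unfolding S_def T_def by (rule spread_sum(1)[OF k gap])
  \<comment> \<open>\<open>R\<close> is the term with every factor normalized to have a finite
    limit; the leftover power of \<open>1 / a\<close> is treated separately.\<close>
  define R where "R a = (\<Prod>m<n. (a ^ (2 * \<sigma> m) * quad_weight p d a (\<sigma> m)) *
      (\<Prod>l<m. node p a (\<sigma> m) / a - node p a (k * l) / a)) *
      (\<Prod>m<n. \<Prod>l<m. pair_factor p k (node p a (\<sigma> m)) (node p a (\<sigma> l)) / a ^ (2 * k - 1))" for a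
  define R0 where "R0 = (\<Prod>m<n. weight_limit p (\<sigma> m) * (\<Prod>l<m. p ^ \<sigma> m - p ^ (k * l))) *
      (\<Prod>m<n. \<Prod>l<m. pair_lead p k (p ^ \<sigma> m) (p ^ \<sigma> l))"
  have R: "(R \<longlongrightarrow> R0) at_infinity"
    unfolding R_def R0_def
    by (intro tendsto_intros tendsto_quad_weight tendsto_node tendsto_pair_factor p p0 k le) auto
  have lim: "((\<lambda>a. R a * (1 / a) ^ (2 * (T - k * S))) \<longlongrightarrow> R0 * 0 ^ (2 * (T - k * S))) at_infinity"
    by (intro tendsto_intros R tendsto_const_divide_at_infinity)
  have eq: "R a * (1 / a) ^ (2 * (T - k * S)) = ?E a" if a: "a \<noteq> 0" for a
  proof -
    have "(\<Prod>m<n. a ^ (2 * \<sigma> m)) = a ^ (2 * T)"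
      by (simp add: T_def power_sum sum_distrib_left)
    moreover have const: "(\<Prod>m<n. \<Prod>l<m. c) = c ^ S" for c :: complex
      by (simp add: S_def power_sum)
    ultimately have "R a = ?E a * a ^ (2 * T) / (a ^ S * (a ^ (2 * k - 1)) ^ S)"
      by (simp add: R_def prod.distrib prod_dividef pair_prod_def flip: diff_divide_distrib)
    also have "a ^ S * (a ^ (2 * k - 1)) ^ S = a ^ (2 * (k * S))"
    proof -
      have "S + (2 * k - 1) * S = 2 * (k * S)"
        using k by (cases k) (simp_all add: algebra_simps)
      then show ?thesis by (simp flip: power_mult power_add)
    qed
    also have "a ^ (2 * T) = a ^ (2 * (k * S)) * a ^ (2 * (T - k * S))"
      using ST by (simp flip: power_add add: diff_mult_distrib2)
    finally show ?thesis using a by (simp add: power_divide)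
  qed
  \<comment> \<open>The power of 0 is 1 if \<open>T = k * S\<close> and 0 otherwise.\<close>
  have "R0 * 0 ^ (2 * (T - k * S)) = ?L"
  proof (cases "T = k * S")
    case True
    show ?thesis
    proof (cases "\<forall>m<n. \<sigma> m = k * m")
      case all: True
      then have "R0 = spread_limit p k n"
        unfolding R0_def spread_limit_def
        by (intro arg_cong2[of _ _ _ _ "(*)"] prod.cong refl) auto
      with all \<open>T = k * S\<close> show ?thesis by simp
    next
      case False
      have "\<exists>l m. l < m \<and> m < n \<and> \<sigma> m = k * l"
      proof (rule ccontr)
        assume none: "\<not> ?thesis"
        have "\<sigma> m = k * m" if "m < n" for m
          using True none that
          by (intro spread_sum(2)[where n = n, OF k gap]) (auto simp: S_def T_def)
        with False show False by blast
      qed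
      then obtain l' m' where lm: "l' < m'" "m' < n" "\<sigma> m' = k * l'" by blast
      then have "(\<Prod>l<m'. p ^ \<sigma> m' - p ^ (k * l)) = 0"
        by (intro prod_zero bexI[of _ l']) simp_all
      then have "(\<Prod>m<n. weight_limit p (\<sigma> m) * (\<Prod>l<m. p ^ \<sigma> m - p ^ (k * l))) = 0"
        using lm by (intro prod_zero bexI[of _ m']) simp_all
      then have "R0 = 0" by (simp add: R0_def)
      then show ?thesis unfolding if_not_P[OF False] by simp
    qed
  next
    case False
    have *: "\<not> (\<forall>m<n. \<sigma> m = k * m)"
    proof
      assume "\<forall>m<n. \<sigma> m = k * m"
      then have "T = (\<Sum>m<n. k * m)" unfolding T_def by (intro sum.cong) auto
      with False show False by (simp add: S_def sum_distrib_left)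
    qed
    have "T - k * S > 0" using False ST by simp
    then show ?thesis unfolding if_not_P[OF *] by simp
  qed
  with lim have "((\<lambda>a. R a * (1 / a) ^ (2 * (T - k * S))) \<longlongrightarrow> ?L) at_infinity" by simp
  then show ?thesis
    by (rule Lim_transform_eventually) (use eventually_nonzero_at_infinity eq in \<open>auto elim: eventually_mono\<close>)
qed

lemma degree_coeff_prod_linear:
  fixes c :: "nat \<Rightarrow> complex"
  shows "degree (\<Prod>l<m. [:- c l, 1:]) = m" and "coeff (\<Prod>l<m. [:- c l, 1:]) m = 1"
proof -
  have "lead_coeff (\<Prod>l<m. [:- c l, 1:]) = 1" by (simp add: lead_coeff_prod)
  moreover show "degree (\<Prod>l<m. [:- c l, 1:]) = m" by (subst degree_prod_eq_sum_degree) auto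
  ultimately show "coeff (\<Prod>l<m. [:- c l, 1:]) m = 1" by simp
qed

section \<open>The functional in several variables\<close>

text \<open>The value of \<open>L\<^sub>a\<close> taken in each of the \<open>n\<close> variables,
  on the product of the \<open>P m\<close> in their own variables times the polynomial listed in
  \<open>xs\<close>, as a polynomial in \<open>a\<close>.\<close>

definition tensor_mean ::
  "complex \<Rightarrow> nat \<Rightarrow> (nat \<Rightarrow> complex poly) \<Rightarrow> (complex \<times> (nat \<Rightarrow> nat)) list \<Rightarrow> complex poly"
  where "tensor_mean p n P xs =
    (\<Sum>(c, e)\<leftarrow>xs. smult c (\<Prod>m<n. hermite_mean p (P m * monom 1 (e m))))"

lemma tensor_mean_Nil [simp]: "tensor_mean p n P [] = 0"
  by (simp add: tensor_mean_def)

lemma tensor_mean_Cons [simp]: "tensor_mean p n P (x # xs) =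
    smult (fst x) (\<Prod>m<n. hermite_mean p (P m * monom 1 (snd x m))) + tensor_mean p n P xs"
  by (simp add: tensor_mean_def case_prod_unfold)

text \<open>For a single monomial the functional is a product of one-variable quadratures, and
  expanding this product gives a sum over all choices \<open>\<sigma>\<close> of nodes.\<close>

lemma tensor_mean_quadrature:
  assumes "p \<noteq> 0" "a \<noteq> 0" "inj_on (node p a) {..d}"
    and "\<And>x m. x \<in> set xs \<Longrightarrow> m < n \<Longrightarrow> degree (P m * monom 1 (snd x m)) \<le> d"
  shows "poly (tensor_mean p n P xs) a =
    (\<Sum>\<sigma>\<in>{..<n} \<rightarrow>\<^sub>E {..d}. (\<Prod>m<n. quad_weight p d a (\<sigma> m) * poly (P m) (node p a (\<sigma> m))) *
      monomial_sum n xs (\<lambda>m. node p a (\<sigma> m)))"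
  using assms(4)
proof (induction xs)
  case (Cons x xs)
  have "(\<Prod>m<n. poly (hermite_mean p (P m * monom 1 (snd x m))) a) =
      (\<Prod>m<n. \<Sum>i\<le>d. quad_weight p d a i * (poly (P m) (node p a i) * node p a i ^ snd x m))"
    using Cons.prems assms(1-3)
    by (intro prod.cong refl, subst hermite_mean_quadrature[where d = d]) (auto simp: poly_monom)
  also have "\<dots> = (\<Sum>\<sigma>\<in>{..<n} \<rightarrow>\<^sub>E {..d}.
      (\<Prod>m<n. quad_weight p d a (\<sigma> m) * (poly (P m) (node p a (\<sigma> m)) * node p a (\<sigma> m) ^ snd x m)))"
    by (rule prod_sum_PiE) auto
  finally have "(\<Prod>m<n. poly (hermite_mean p (P m * monom 1 (snd x m))) a) =
      (\<Sum>\<sigma>\<in>{..<n} \<rightarrow>\<^sub>E {..d}. (\<Prod>m<n. quad_weight p d a (\<sigma> m) * poly (P m) (node p a (\<sigma> m))) *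
        (\<Prod>m<n. node p a (\<sigma> m) ^ snd x m))"
    by (simp only: prod.distrib mult.assoc)
  moreover have "poly (tensor_mean p n P xs) a =
    (\<Sum>\<sigma>\<in>{..<n} \<rightarrow>\<^sub>E {..d}. (\<Prod>m<n. quad_weight p d a (\<sigma> m) * poly (P m) (node p a (\<sigma> m))) *
      monomial_sum n xs (\<lambda>m. node p a (\<sigma> m)))"
    using Cons by simp
  ultimately show ?case
    by (simp add: poly_prod distrib_left sum.distrib sum_distrib_left mult.left_commute)
qed simp

text \<open>For large \<open>a\<close> the polynomial is a finite sum of configurations, of which
  only one has a nonzero contribution in the limit. A polynomial with a finite limit at infinity is
  constant, so the limit is its value everywhere; the value at \<open>a = 1\<close> is the one
  needed for the multiple sum.\<close>

lemma tensor_mean_monic: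
  assumes p: "norm p > 1" and k: "k \<ge> 1"
    and P: "\<And>m. m < n \<Longrightarrow> degree (P m) = m" "\<And>m. m < n \<Longrightarrow> coeff (P m) m = 1"
    and xs: "\<And>u. pair_prod p k n u = monomial_sum n xs u"
  shows "poly (tensor_mean p n P xs) a = spread_limit p k n"
proof -
  have p0: "p \<noteq> 0" using p by auto
  let ?K = "tensor_mean p n P xs"
  define D where "D = (\<lambda>(x, m). degree (P m * monom 1 (snd x m))) ` (set xs \<times> {..<n})"
  \<comment> \<open>The order must bound all degrees that occur and also leave room for the indices
    \<open>k * m\<close> of the surviving configuration.\<close>
  define d where "d = k * n + Max (insert 0 D)"
  have "finite D" by (simp add: D_def)
  then have d: "degree (P m * monom 1 (snd x m)) \<le> d" if "x \<in> set xs" "m < n" for x m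
    unfolding d_def using that by (intro trans_le_add2 Max_ge) (auto simp: D_def)
  let ?I = "{..<n} \<rightarrow>\<^sub>E {..d}"
  let ?\<sigma> = "restrict (\<lambda>m. k * m) {..<n}"
  define Q where "Q a m = (\<Prod>l<m. [:- node p a (k * l), 1:])" for a m
  have fin: "finite ?I" by (intro finite_PiE) auto
  have "((\<lambda>a. \<Sum>\<sigma>\<in>?I. (\<Prod>m<n. quad_weight p d a (\<sigma> m) *
      (\<Prod>l<m. node p a (\<sigma> m) - node p a (k * l))) * pair_prod p k n (\<lambda>m. node p a (\<sigma> m))) \<longlongrightarrow>
      (\<Sum>\<sigma>\<in>?I. if \<forall>m<n. \<sigma> m = k * m then spread_limit p k n else 0)) at_infinity"
    by (intro tendsto_sum tendsto_configuration p k) (auto simp: PiE_iff)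
  also have "(\<Sum>\<sigma>\<in>?I. if \<forall>m<n. \<sigma> m = k * m then spread_limit p k n else 0) =
      (\<Sum>\<sigma>\<in>?I. if \<sigma> = ?\<sigma> then spread_limit p k n else 0)"
  proof (intro sum.cong refl)
    fix \<sigma> assume \<sigma>: "\<sigma> \<in> ?I"
    have "(\<forall>m<n. \<sigma> m = k * m) \<longleftrightarrow> \<sigma> = ?\<sigma>"
    proof
      assume "\<forall>m<n. \<sigma> m = k * m"
      then show "\<sigma> = ?\<sigma>" using \<sigma> by (auto simp: PiE_iff extensional_def fun_eq_iff)
    qed auto
    then show "(if \<forall>m<n. \<sigma> m = k * m then spread_limit p k n else 0) =
        (if \<sigma> = ?\<sigma> then spread_limit p k n else 0)" by simp
  qed
  also have "\<dots> = spread_limit p k n"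
  proof -
    have "?\<sigma> \<in> ?I" by (auto simp: d_def intro!: trans_le_add1)
    then show ?thesis using fin by (subst sum.delta) auto
  qed
  finally have lim: "((\<lambda>a. \<Sum>\<sigma>\<in>?I. (\<Prod>m<n. quad_weight p d a (\<sigma> m) *
      (\<Prod>l<m. node p a (\<sigma> m) - node p a (k * l))) * pair_prod p k n (\<lambda>m. node p a (\<sigma> m))) \<longlongrightarrow>
      spread_limit p k n) at_infinity" .
  from lim have "(poly ?K \<longlongrightarrow> spread_limit p k n) at_infinity"
  proof (rule Lim_transform_eventually)
    show "\<forall>\<^sub>F a in at_infinity. (\<Sum>\<sigma>\<in>?I. (\<Prod>m<n. quad_weight p d a (\<sigma> m) *
      (\<Prod>l<m. node p a (\<sigma> m) - node p a (k * l))) * pair_prod p k n (\<lambda>m. node p a (\<sigma> m))) = poly ?K a"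
      using eventually_nonzero_at_infinity eventually_inj_node[OF p, of d]
    proof eventually_elim
      case (elim a)
      let ?G = "\<lambda>\<sigma>. pair_prod p k n (\<lambda>m. node p a (\<sigma> m))"
      have anti: "?G (\<sigma> \<circ> Transposition.transpose i (Suc i)) = - ?G \<sigma>" if "Suc i < n" for \<sigma> i
        using pair_prod_transpose[OF that, of p k "\<lambda>m. node p a (\<sigma> m)"] by (simp add: o_def)
      have "poly ?K a = (\<Sum>\<sigma>\<in>?I. (\<Prod>m<n. quad_weight p d a (\<sigma> m) * poly (P m) (node p a (\<sigma> m))) * ?G \<sigma>)"
        using tensor_mean_quadrature[OF p0 elim, of xs n P] d xs by simp
      \<comment> \<open>The given monic polynomials are exchanged for ones depending on
        \<open>a\<close>, with roots at the nodes of index \<open>k * l\<close>,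
        \<open>l < m\<close>; both sums equal the one with pure powers.\<close>
      also have "\<dots> = (\<Sum>\<sigma>\<in>?I. (\<Prod>m<n. quad_weight p d a (\<sigma> m) * poly (Q a m) (node p a (\<sigma> m))) * ?G \<sigma>)"
        unfolding Q_def
        by (rule trans[OF alternating_sum_monic alternating_sum_monic[symmetric]])
          (rule anti P degree_coeff_prod_linear; assumption?)+
      finally show ?case by (simp add: Q_def poly_prod)
    qed
  qed
  note K = this
  \<comment> \<open>A polynomial of positive degree is unbounded at infinity.\<close>
  have "degree ?K = 0"
  proof (rule ccontr)
    assume "degree ?K \<noteq> 0"
    then have "filterlim (poly ?K) at_infinity at_infinity"
      by (intro filterlim_poly_at_infinity) simp
    with K show False
      using not_tendsto_and_filterlim_at_infinity[OF trivial_limit_at_infinity] by blast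
  qed
  then obtain c where c: "?K = [:c:]" by (rule degree_eq_zeroE)
  then have "poly ?K = (\<lambda>_. c)" by (simp add: fun_eq_iff)
  with K have "((\<lambda>_::complex. c) \<longlongrightarrow> spread_limit p k n) at_infinity" by simp
  then show ?thesis
    using tendsto_const_iff[OF trivial_limit_at_infinity] c by auto
qed

section \<open>Sums against the pentagonal weight\<close>

definition tri :: "int \<Rightarrow> int" where "tri v = v * (v - 1) div 2"

lemma two_tri: "2 * tri v = v * (v - 1)"
  by (simp add: tri_def)

text \<open>The exponent is the generalized pentagonal number \<open>v (3v - 1) / 2\<close>.\<close>

definition pent :: "complex \<Rightarrow> int \<Rightarrow> complex"
  where "pent q v = (-1) powi v * q powi (3 * tri v + v)"

lemma tri_add1: "tri (v + 1) = tri v + v"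
  using two_tri[of v] two_tri[of "v + 1"] by (simp add: algebra_simps)

lemma tri_minus: "tri (- v) = tri v + v"
  using two_tri[of v] two_tri[of "- v"] by (simp add: algebra_simps)

lemma pent_minus: "q \<noteq> 0 \<Longrightarrow> pent q (- v) = pent q v * q powi v"
proof -
  assume "q \<noteq> 0"
  have "(-1 :: complex) powi (- v) = (-1) powi v"
    by (simp add: power_int_minus power_int_minus_left)
  moreover have "3 * tri (- v) + (- v) = (3 * tri v + v) + v"
    by (simp add: tri_minus)
  then have "q powi (3 * tri (- v) + (- v)) = q powi (3 * tri v + v) * q powi v"
    using \<open>q \<noteq> 0\<close> by (metis power_int_add)
  ultimately show ?thesis
    by (simp only: pent_def mult.assoc)
qed

section \<open>Summability against the pentagonal weight\<close>

lemma summable_on_power_nat_abs: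
  fixes x :: real
  assumes "0 \<le> x" "x < 1"
  shows "(\<lambda>v :: int. x ^ nat \<bar>v\<bar>) summable_on UNIV"
proof -
  have geo: "(\<lambda>n::nat. x ^ n) summable_on UNIV"
    using assms by (subst summable_on_UNIV_nonneg_real_iff) (auto intro: summable_geometric)
  have "(\<lambda>v :: int. x ^ nat \<bar>v\<bar>) summable_on {0..}"
    using geo by (subst summable_on_reindex_bij_witness[of "{0..}" int nat UNIV "\<lambda>n. x ^ n"]) auto
  moreover have "(\<lambda>v :: int. x ^ nat \<bar>v\<bar>) summable_on {..<0}"
  proof -
    have "(\<lambda>n::nat. x ^ Suc n) summable_on UNIV"
      using summable_on_cmult_right[OF geo, of x] by simp
    moreover have "Suc (nat (- v - 1)) = nat \<bar>v\<bar>" if "v < 0" for v :: int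
      using that by simp
    ultimately show ?thesis
      by (subst summable_on_reindex_bij_witness[of "{..<0}" "\<lambda>n. - int n - 1" "\<lambda>v. nat (- v - 1)" UNIV "\<lambda>n. x ^ Suc n"])
        (auto simp del: power_Suc)
  qed
  ultimately have "(\<lambda>v :: int. x ^ nat \<bar>v\<bar>) summable_on ({0..} \<union> {..<0})"
    by (rule summable_on_Un_disjoint) auto
  also have "{0..} \<union> {..<0} = (UNIV :: int set)" by auto
  finally show ?thesis .
qed

text \<open>Summability is demanded together with every factor \<open>q powi (j * v)\<close>, so
  that the class is closed under multiplication by powers of \<open>q\<^sup>v\<close> and hence by
  polynomials in \<open>u\<close>.\<close>

definition tame :: "complex \<Rightarrow> (int \<Rightarrow> complex) \<Rightarrow> bool"
  where "tame q f \<longleftrightarrow> (\<forall>j. (\<lambda>v. norm (pent q v * q powi (j * v) * f v)) summable_on UNIV)"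

text \<open>The exponent is quadratic in \<open>v\<close> with positive leading coefficient, so it
  exceeds \<open>\<bar>v\<bar>\<close> minus a constant, and a two-sided geometric series
  dominates.\<close>

lemma tame_1:
  assumes "q \<noteq> 0" "norm q < 1"
  shows "tame q (\<lambda>_. 1)"
  unfolding tame_def
proof
  fix j :: int
  define J where "J = \<bar>j\<bar>"
  define c where "c = (J + 2)\<^sup>2"
  have bound: "norm (pent q v * q powi (j * v)) \<le> norm q powi (- c) * norm q ^ nat \<bar>v\<bar>" for v
  proof -
    define w where "w = \<bar>v\<bar>"
    \<comment> \<open>Completing the square explains the choice of \<open>c\<close>: twice the
      exponent is at least \<open>3 w\<^sup>2 - w - 2 J w\<close>, and this is at least
      \<open>2 w - 2 c\<close>.\<close>
    have "0 \<le> (w - (J + 2))\<^sup>2 + 2 * w\<^sup>2 + w + (J + 2)\<^sup>2" by (simp add: w_def)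
    also have "\<dots> = 3 * w\<^sup>2 - (2 * (J * w) + 3 * w) + 2 * c"
      by (simp add: c_def power2_eq_square algebra_simps)
    finally have "0 \<le> 3 * w\<^sup>2 - (2 * (J * w) + 3 * w) + 2 * c" .
    moreover have "- (J * w) \<le> j * v"
      unfolding w_def J_def abs_mult[symmetric] by linarith
    moreover have "w\<^sup>2 = v * v" by (simp add: w_def power2_eq_square)
    moreover have "2 * (3 * tri v + v + j * v) = 3 * (v * v) - v + 2 * (j * v)"
      using two_tri[of v] by (simp add: algebra_simps)
    moreover have "v \<le> w" "0 \<le> w" by (simp_all add: w_def)
    moreover have "w - c \<le> T" if "0 \<le> 3 * s - (2 * a + 3 * w) + 2 * c" "- a \<le> b" "s = t"
      "2 * T = 3 * t - v + 2 * b" "v \<le> w" "0 \<le> w" for s a b t T :: int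
      using that by linarith
    ultimately have "w - c \<le> 3 * tri v + v + j * v" by blast
    then have "norm q powi (3 * tri v + v + j * v) \<le> norm q powi (w - c)"
      using assms by (intro power_int_decreasing) auto
    also have "\<dots> = norm q powi (- c) * norm q powi w"
      using assms by (simp flip: power_int_add)
    also have "norm q powi w = norm q ^ nat \<bar>v\<bar>"
      by (simp add: w_def power_int_def)
    finally show ?thesis
      using assms by (simp add: pent_def norm_mult norm_power_int power_int_add)
  qed
  have "(\<lambda>v. norm q powi (- c) * norm q ^ nat \<bar>v\<bar>) summable_on (UNIV :: int set)"
    using assms by (intro summable_on_cmult_right summable_on_power_nat_abs) auto
  then show "(\<lambda>v. norm (pent q v * q powi (j * v) * 1)) summable_on UNIV"
    by (rule summable_on_comparison_test) (use bound in auto)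
qed

lemma tame_add: "tame q f \<Longrightarrow> tame q g \<Longrightarrow> tame q (\<lambda>v. f v + g v)"
  unfolding tame_def
proof
  fix j
  assume "\<forall>j. (\<lambda>v. norm (pent q v * q powi (j * v) * f v)) summable_on UNIV"
    "\<forall>j. (\<lambda>v. norm (pent q v * q powi (j * v) * g v)) summable_on UNIV"
  then have "(\<lambda>v. norm (pent q v * q powi (j * v) * f v) + norm (pent q v * q powi (j * v) * g v))
      summable_on UNIV"
    by (intro summable_on_add) auto
  then show "(\<lambda>v. norm (pent q v * q powi (j * v) * (f v + g v))) summable_on UNIV"
    by (rule summable_on_comparison_test)
      (auto simp: distrib_left intro: norm_triangle_ineq)
qed

lemma tame_cmult: "tame q f \<Longrightarrow> tame q (\<lambda>v. c * f v)"
  unfolding tame_def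
proof
  fix j
  assume "\<forall>j. (\<lambda>v. norm (pent q v * q powi (j * v) * f v)) summable_on UNIV"
  then have "(\<lambda>v. norm c * norm (pent q v * q powi (j * v) * f v)) summable_on UNIV"
    by (intro summable_on_cmult_right) auto
  then show "(\<lambda>v. norm (pent q v * q powi (j * v) * (c * f v))) summable_on UNIV"
    by (simp add: norm_mult mult_ac)
qed

lemma tame_powi: "q \<noteq> 0 \<Longrightarrow> tame q f \<Longrightarrow> tame q (\<lambda>v. q powi (i * v) * f v)"
  unfolding tame_def
proof
  fix j
  assume "q \<noteq> 0" "\<forall>j. (\<lambda>v. norm (pent q v * q powi (j * v) * f v)) summable_on UNIV"
  moreover have "pent q v * q powi (j * v) * (q powi (i * v) * f v) =
      pent q v * q powi ((j + i) * v) * f v" for v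
    using power_int_add[OF disjI1[OF \<open>q \<noteq> 0\<close>], of "j * v" "i * v"]
    by (simp only: distrib_right[of j i v] mult.assoc)
  ultimately show "(\<lambda>v. norm (pent q v * q powi (j * v) * (q powi (i * v) * f v))) summable_on UNIV"
    by (simp only:)
qed

lemma tame_imp_summable: "tame q f \<Longrightarrow> (\<lambda>v. norm (pent q v * f v)) summable_on UNIV"
  unfolding tame_def by (drule spec[of _ 0]) simp

lemma tame_imp_summable': "tame q f \<Longrightarrow> (\<lambda>v. pent q v * f v) summable_on UNIV"
  by (rule Infinite_Sum.abs_summable_summable, rule tame_imp_summable)

definition usym :: "complex \<Rightarrow> int \<Rightarrow> complex"
  where "usym q v = q powi v + 1 / q powi v"

lemma usym_minus: "usym q (- v) = usym q v"
  by (simp add: usym_def power_int_minus field_simps)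

lemma tame_usym: "q \<noteq> 0 \<Longrightarrow> tame q f \<Longrightarrow> tame q (\<lambda>v. usym q v * f v)"
  using tame_add[OF tame_powi[of q f 1] tame_powi[of q f "-1"]]
  by (simp add: usym_def power_int_minus field_simps)

lemma tame_poly:
  assumes "q \<noteq> 0" "tame q g"
  shows "tame q (\<lambda>v. g v * poly f (usym q v))"
proof (induction f)
  case 0
  show ?case using tame_cmult[OF assms(2), of 0] by simp
next
  case (pCons c f)
  have "tame q (\<lambda>v. c * g v + usym q v * (g v * poly f (usym q v)))"
    by (intro tame_add tame_cmult assms tame_usym pCons)
  then show ?case by (simp add: algebra_simps)
qed

definition pent_sum :: "complex \<Rightarrow> (int \<Rightarrow> complex) \<Rightarrow> complex"
  where "pent_sum q f = (\<Sum>\<^sub>\<infinity>v. pent q v * f v)"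

lemma pent_sum_add:
  assumes "tame q f" "tame q g"
  shows "pent_sum q (\<lambda>v. f v + g v) = pent_sum q f + pent_sum q g"
  unfolding pent_sum_def distrib_left
  by (intro infsum_add tame_imp_summable' assms)

lemma pent_sum_cmult: "pent_sum q (\<lambda>v. c * f v) = c * pent_sum q f"
  unfolding pent_sum_def by (simp add: mult.left_commute infsum_cmult_right')

lemma pent_sum_reflect:
  assumes "q \<noteq> 0"
  shows "pent_sum q f = pent_sum q (\<lambda>v. q powi v * f (- v))"
proof -
  have "pent_sum q f = (\<Sum>\<^sub>\<infinity>v. pent q (- v) * f (- v))"
    unfolding pent_sum_def by (rule infsum_reindex_bij_witness[of _ uminus uminus]) auto
  then show ?thesis using assms by (simp add: pent_sum_def pent_minus mult.assoc)
qed

text \<open>The weight at \<open>-v\<close> is the weight at \<open>v\<close> times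
  \<open>q powi v\<close>, so for even \<open>f\<close> the part with \<open>q powi v\<close> is the
  reflection of the other part.\<close>

lemma pent_sum_even:
  assumes "q \<noteq> 0" "tame q f" "\<And>v. f (- v) = f v"
  shows "pent_sum q (\<lambda>v. (1 + q powi v) * f v) = 2 * pent_sum q f"
proof -
  have "pent_sum q (\<lambda>v. (1 + q powi v) * f v) = pent_sum q (\<lambda>v. f v + q powi v * f v)"
    by (simp add: distrib_right)
  also have "\<dots> = pent_sum q f + pent_sum q (\<lambda>v. q powi v * f v)"
    using tame_powi[OF assms(1,2), of 1] by (intro pent_sum_add assms) simp
  also have "pent_sum q (\<lambda>v. q powi v * f v) = pent_sum q f"
    using pent_sum_reflect[OF assms(1), of f] assms(3) by simp
  finally show ?thesis by simp
qed

text \<open>Orthogonal characters \<open>s\<^sub>m = (x\<^bsup>m+1\<^esup> + x\<^bsup>-m\<^esup>) / (1 + x)\<close>, as polynomials in \<open>u\<close>.\<close>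

fun orth_char :: "nat \<Rightarrow> complex poly" where
  "orth_char 0 = 1"
| "orth_char (Suc 0) = [:-1, 1:]"
| "orth_char (Suc (Suc m)) = pCons 0 (orth_char (Suc m)) - orth_char m"

lemma orth_char_monic: "degree (orth_char m) = m \<and> coeff (orth_char m) m = 1"
proof (induction m rule: orth_char.induct)
  case (3 m)
  have "degree (orth_char m) < Suc (Suc m)" using 3 by simp
  then have "coeff (orth_char m) (Suc (Suc m)) = 0" by (rule coeff_eq_0)
  then have coeff: "coeff (orth_char (Suc (Suc m))) (Suc (Suc m)) = 1" using 3 by simp
  have "degree (pCons 0 (orth_char (Suc m))) \<le> Suc (Suc m)"
    using 3 degree_pCons_le[of 0 "orth_char (Suc m)"] by simp
  then have "degree (orth_char (Suc (Suc m))) \<le> Suc (Suc m)"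
    using 3 by (auto intro: degree_diff_le)
  moreover have "Suc (Suc m) \<le> degree (orth_char (Suc (Suc m)))"
    by (rule le_degree) (use coeff in simp)
  ultimately have "degree (orth_char (Suc (Suc m))) = Suc (Suc m)" by (rule antisym)
  then show ?case using coeff by blast
qed auto

lemma poly_orth_char:
  assumes "x \<noteq> 0"
  shows "(1 + x) * poly (orth_char m) (x + 1/x) = x ^ Suc m + 1 / x ^ m"
proof (induction m rule: orth_char.induct)
  case (3 m)
  have "(1 + x) * poly (orth_char (Suc (Suc m))) (x + 1/x) =
      (x + 1/x) * ((1 + x) * poly (orth_char (Suc m)) (x + 1/x)) - (1 + x) * poly (orth_char m) (x + 1/x)"
    by (simp only: orth_char.simps poly_diff poly_pCons right_diff_distrib mult.left_commute add_0)
  also have "\<dots> = (x + 1/x) * (x ^ Suc (Suc m) + 1 / x ^ Suc m) - (x ^ Suc m + 1 / x ^ m)"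
    by (simp only: 3)
  also have "\<dots> = x ^ Suc (Suc (Suc m)) + 1 / x ^ Suc (Suc m)"
    using assms by (simp add: field_simps)
  finally show ?case .
qed (use assms in \<open>simp_all add: field_simps power2_eq_square\<close>)

lemma pent_sum_orth_char:
  assumes "q \<noteq> 0" "norm q < 1"
  shows "pent_sum q (\<lambda>v. 1 / (q powi v) ^ m * poly f (usym q v)) =
    pent_sum q (\<lambda>v. poly (orth_char m * f) (usym q v))"
proof -
  let ?g = "\<lambda>v. poly f (usym q v)"
  have g: "tame q ?g" using tame_poly[OF assms(1) tame_1[OF assms], of f] by simp
  have t1: "tame q (\<lambda>v. 1 / (q powi v) ^ m * ?g v)"
    using tame_powi[OF assms(1) g, of "- int m"] assms
    by (simp add: power_int_minus power_int_mult power_int_power field_simps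
        flip: power_int_of_nat)
  have t2: "tame q (\<lambda>v. (q powi v) ^ Suc m * ?g v)"
    using tame_powi[OF assms(1) g, of "int (Suc m)"] assms
    by (simp add: power_int_mult power_int_power mult.commute flip: power_int_of_nat del: power_Suc of_nat_Suc)
  have "2 * pent_sum q (\<lambda>v. poly (orth_char m * f) (usym q v)) =
      pent_sum q (\<lambda>v. (1 + q powi v) * poly (orth_char m * f) (usym q v))"
    using tame_poly[OF assms(1) tame_1[OF assms], of "orth_char m * f"]
    by (intro pent_sum_even[symmetric] assms) (simp_all add: usym_minus)
  also have "\<dots> = pent_sum q (\<lambda>v. 1 / (q powi v) ^ m * ?g v + (q powi v) ^ Suc m * ?g v)"
    using poly_orth_char[of "q powi v" m for v] assms
    by (intro arg_cong[of _ _ "pent_sum q"] ext)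
      (simp only: poly_mult mult.assoc[symmetric] usym_def, simp add: distrib_right add.commute)
  also have "\<dots> = pent_sum q (\<lambda>v. 1 / (q powi v) ^ m * ?g v) + pent_sum q (\<lambda>v. (q powi v) ^ Suc m * ?g v)"
    by (rule pent_sum_add[OF t1 t2])
  also have "pent_sum q (\<lambda>v. (q powi v) ^ Suc m * ?g v) = pent_sum q (\<lambda>v. 1 / (q powi v) ^ m * ?g v)"
    by (subst pent_sum_reflect[OF assms(1)])
      (use assms in \<open>simp add: usym_minus power_int_minus power_divide field_simps\<close>)
  finally show ?thesis by simp
qed

section \<open>Products vanishing near the origin and telescoping\<close>

text \<open>With \<open>x = q\<^sup>v\<close> and \<open>p = 1/q\<close> this is the product of
  \<open>(1 - p\<^sup>l x)(1 - p\<^sup>l / x)\<close> over \<open>l < m\<close>, the factors that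
  move the parameter of \<open>L\<close> from 1 to \<open>p\<^sup>m\<close>. It is zero for
  \<open>\<bar>v\<bar> < m\<close>.\<close>

definition vanish :: "complex \<Rightarrow> nat \<Rightarrow> int \<Rightarrow> complex"
  where "vanish q m v = (\<Prod>l<m. (1 - q powi (v - int l)) * (1 - q powi (- v - int l)))"

text \<open>A variant of \<open>vanish\<close> with zeros at \<open>1 - m \<le> v \<le> m\<close>,
  symmetric about 1/2; it serves as the telescoping certificate.\<close>

definition half_vanish :: "complex \<Rightarrow> nat \<Rightarrow> int \<Rightarrow> complex"
  where "half_vanish q m v = (\<Prod>l<m. (1 - q powi (v - int l - 1)) * (1 - q powi (- v - int l)))"

lemma vanish_Suc:
  assumes "q \<noteq> 0"
  shows "vanish q (Suc m) v =
    vanish q m v * (- ((1 / q) ^ m) * (usym q v - ((1 / q) ^ m + 1 / (1 / q) ^ m)))"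
proof -
  define x Q where "x = q powi v" and "Q = q ^ m"
  have "x \<noteq> 0" "Q \<noteq> 0" using assms by (auto simp: x_def Q_def)
  then have "(1 - x / Q) * (1 - 1 / (x * Q)) = - (1 / Q) * (x + 1 / x - (1 / Q + 1 / (1 / Q)))"
    by (simp add: field_simps)
  moreover have "q powi (v - int m) = x / Q" "q powi (- v - int m) = 1 / (x * Q)"
    using assms by (simp_all add: x_def Q_def power_int_diff power_int_minus field_simps)
  ultimately show ?thesis
    by (simp add: vanish_def usym_def x_def Q_def power_one_over)
qed

lemma vanish_minus: "vanish q m (- v) = vanish q m v"
  by (simp add: vanish_def mult.commute)

lemma tame_vanish_mult:
  assumes "q \<noteq> 0" "tame q g"
  shows "tame q (\<lambda>v. vanish q m v * g v)"
proof (induction m)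
  case 0
  then show ?case using assms by (simp add: vanish_def)
next
  case (Suc m)
  let ?c = "(1 / q) ^ m" and ?d = "(1 / q) ^ m + 1 / (1 / q) ^ m"
  have "tame q (\<lambda>v. (- ?c) * (usym q v * (vanish q m v * g v)) + ?c * ?d * (vanish q m v * g v))"
    by (intro tame_add tame_cmult tame_usym Suc assms)
  also have "(\<lambda>v. (- ?c) * (usym q v * (vanish q m v * g v)) + ?c * ?d * (vanish q m v * g v)) =
      (\<lambda>v. vanish q (Suc m) v * g v)"
    by (simp only: vanish_Suc[OF assms(1)]) (simp add: algebra_simps)
  finally show ?case .
qed

lemma powi_eq_1_iff:
  assumes "q \<noteq> 0" "norm (q::complex) < 1"
  shows "q powi v = 1 \<longleftrightarrow> v = 0"
proof
  assume 1: "q powi v = 1"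
  have *: "q ^ n \<noteq> 1" if "n > 0" for n
  proof
    assume "q ^ n = 1"
    then have "norm q ^ n = 1" by (metis norm_one norm_power)
    with that assms(2) power_less_one_iff[of "norm q" n] show False by simp
  qed
  have "q ^ nat \<bar>v\<bar> = 1"
    using 1 by (cases "v \<ge> 0") (simp_all add: power_int_def power_inverse)
  with *[of "nat \<bar>v\<bar>"] show "v = 0" by force
qed auto

text \<open>Shifting the index by one in the first family of factors trades its factor with
  \<open>l = 0\<close> for the one with \<open>l = m\<close>. The next lemma does the same for the
  second family.\<close>

lemma half_vanish_1: "q \<noteq> 0 \<Longrightarrow>
  (1 - q powi v) * half_vanish q m v = vanish q m v * (1 - q powi (v - int m))"
proof (induction m)
  case (Suc m)
  have "(1 - q powi v) * half_vanish q (Suc m) v = ((1 - q powi v) * half_vanish q m v) *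
      ((1 - q powi (v - int m - 1)) * (1 - q powi (- v - int m)))"
    by (simp add: half_vanish_def mult_ac)
  also have "\<dots> = vanish q (Suc m) v * (1 - q powi (v - int (Suc m)))"
    unfolding Suc.IH[OF Suc.prems] by (simp add: vanish_def algebra_simps)
  finally show ?case .
qed (simp add: half_vanish_def vanish_def)

lemma half_vanish_2: "q \<noteq> 0 \<Longrightarrow>
  (1 - q powi (- v)) * half_vanish q m (v + 1) = vanish q m v * (1 - q powi (- v - int m))"
proof (induction m)
  case (Suc m)
  have "(1 - q powi (- v)) * half_vanish q (Suc m) (v + 1) =
      ((1 - q powi (- v)) * half_vanish q m (v + 1)) *
      ((1 - q powi (v - int m)) * (1 - q powi (- v - int (Suc m))))"
    by (simp add: half_vanish_def mult_ac diff_diff_eq)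
  also have "\<dots> = vanish q (Suc m) v * (1 - q powi (- v - int (Suc m)))"
    unfolding Suc.IH[OF Suc.prems] by (simp add: vanish_def mult_ac diff_diff_eq)
  finally show ?case .
qed (simp add: half_vanish_def vanish_def)

lemma half_vanish_recurrence:
  assumes "q \<noteq> 0" "norm q < 1"
  shows "(q powi v) ^ 3 * half_vanish q m (v + 1) + half_vanish q m v =
    q powi v * (1 + q powi v) * (usym q v - (1 / q) ^ m) * vanish q m v"
proof (cases "v = 0")
  case True
  show ?thesis
  proof (cases m)
    case 0
    then show ?thesis using True by (simp add: half_vanish_def vanish_def usym_def)
  next
    case (Suc m')
    have "half_vanish q m 1 = 0" "half_vanish q m 0 = 0" "vanish q m 0 = 0"
      by (simp_all add: half_vanish_def vanish_def Suc prod.lessThan_Suc_shift del: prod.lessThan_Suc)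
    then show ?thesis using True by simp
  qed
next
  case False
  define x P \<phi> where "x = q powi v" and "P = (1 / q) ^ m" and "\<phi> = vanish q m v"
  have x: "x \<noteq> 0" "x \<noteq> 1" using assms powi_eq_1_iff[of q v] False by (auto simp: x_def)
  have e: "q powi (v - int m) = x * P" "q powi (- v - int m) = P / x"
    using assms by (simp_all add: x_def P_def power_int_diff power_int_minus power_one_over field_simps)
  have "(1 - x) * half_vanish q m v = \<phi> * (1 - x * P)"
    using half_vanish_1[OF assms(1), of v m] by (simp add: e x_def \<phi>_def)
  then have 1: "half_vanish q m v = \<phi> * (1 - x * P) / (1 - x)"
    using x by (simp add: field_simps)
  have "(1 - 1 / x) * half_vanish q m (v + 1) = \<phi> * (1 - P / x)"
    using half_vanish_2[OF assms(1), of v m] by (simp add: e \<phi>_def) (simp add: x_def power_int_minus field_simps)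
  then have 2: "half_vanish q m (v + 1) = \<phi> * (x - P) / (x - 1)"
    using x by (simp add: field_simps)
  have "x ^ 3 * (\<phi> * (x - P) / (x - 1)) + \<phi> * (1 - x * P) / (1 - x) =
    x * (1 + x) * (x + 1 / x - P) * \<phi>"
  proof -
    have d: "1 - x = - (x - 1)" by simp
    have "x - 1 \<noteq> 0" using x by simp
    then show ?thesis using x(1)
      unfolding d divide_minus_right
      by (simp add: divide_simps) (simp add: algebra_simps power3_eq_cube)
  qed
  then show ?thesis
    unfolding 1 2 by (simp add: x_def P_def \<phi>_def usym_def)
qed

lemma tame_half_vanish:
  assumes "q \<noteq> 0" "norm q < 1"
  shows "tame q (half_vanish q m)"
proof (induction m)
  case 0
  then show ?case using tame_1[OF assms] by (simp add: half_vanish_def)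
next
  case (Suc m)
  define c where "c = q powi (- int m - 1)"
  define d where "d = q powi (- int m)"
  have "half_vanish q (Suc m) v = (1 + c * d) * half_vanish q m v +
      ((- c) * (q powi (1 * v) * half_vanish q m v) + (- d) * (q powi (- 1 * v) * half_vanish q m v))" for v
  proof -
    have "v - int m - 1 = (- int m - 1) + v" by simp
    then have 1: "q powi (v - int m - 1) = c * q powi v"
      by (simp only: c_def power_int_add[OF disjI1[OF assms(1)]])
    have 2: "q powi (- v - int m) = d / q powi v"
      using assms by (simp add: d_def power_int_diff power_int_minus field_simps)
    have 3: "q powi (- 1 * v) = 1 / q powi v"
      by (simp add: power_int_minus field_simps)
    have "q powi v \<noteq> 0" using assms by simp
    then show ?thesis
      unfolding half_vanish_def[of q "Suc m"] prod.lessThan_Suc half_vanish_def[of q m, symmetric] 1 2 3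
      by (simp add: field_simps)
  qed
  moreover have "tame q (\<lambda>v. (1 + c * d) * half_vanish q m v +
      ((- c) * (q powi (1 * v) * half_vanish q m v) + (- d) * (q powi (- 1 * v) * half_vanish q m v)))"
    by (intro tame_add tame_cmult tame_powi Suc assms)
  ultimately show ?case by (simp add: ext)
qed

text \<open>With \<open>P = (1 / q) ^ m\<close>, a telescoping sum shows that
  \<open>(u - P) * vanish q m\<close> has pentagonal sum 0, and \<open>vanish q (Suc m)\<close>
  differs from \<open>vanish q m\<close> by \<open>-P\<close> times this function.\<close>

lemma pent_sum_vanish_step:
  assumes "q \<noteq> 0" "norm q < 1"
  shows "pent_sum q (vanish q (Suc m)) = pent_sum q (vanish q m)"
proof -
  let ?P = "(1 / q) ^ m"
  \<comment> \<open>\<open>G v - G (v + 1)\<close> is, up to symmetrization under \<open>v \<mapsto> -v\<close> and a constant factor, the difference of the two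
    summands.\<close>
  define G where "G v = (-1) powi v * q powi (3 * tri v) * half_vanish q m v" for v
  have t: "tame q (vanish q m)"
    using tame_vanish_mult[OF assms(1) tame_1[OF assms], of m] by simp
  have tu: "tame q (\<lambda>v. (usym q v - ?P) * vanish q m v)"
    using tame_add[OF tame_usym[OF assms(1) t] tame_cmult[OF t, of "- ?P"]]
    by (simp add: algebra_simps)
  have G_eq: "G v = pent q v * (q powi (- 1 * v) * half_vanish q m v)" for v
    using assms by (simp add: G_def pent_def power_int_add power_int_minus field_simps)
  have G_sum: "G summable_on UNIV"
    unfolding G_eq by (intro tame_imp_summable' tame_powi tame_half_vanish assms)
  have diff: "G v - G (v + 1) = pent q v * ((1 + q powi v) * ((usym q v - ?P) * vanish q m v))" for v
  proof -
    have "q powi (3 * tri (v + 1)) = q powi (3 * tri v) * (q powi v) ^ 3"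
      using assms power_int_add[of q "3 * tri v" "3 * v"]
      by (simp add: tri_add1 distrib_left mult.commute power_int_mult)
    moreover have "(-1 :: complex) powi (v + 1) = - ((-1) powi v)"
      by (simp add: power_int_add)
    ultimately have "G v - G (v + 1) = (-1) powi v * q powi (3 * tri v) *
        ((q powi v) ^ 3 * half_vanish q m (v + 1) + half_vanish q m v)"
      by (simp add: G_def algebra_simps)
    also have "\<dots> = pent q v * ((1 + q powi v) * ((usym q v - ?P) * vanish q m v))"
      unfolding half_vanish_recurrence[OF assms] pent_def using assms
      by (simp add: power_int_add mult_ac)
    finally show ?thesis .
  qed
  have bij: "bij (\<lambda>v::int. v + 1)" by (rule bij_betwI[of _ _ _ "\<lambda>v. v - 1"]) auto
  have "(\<lambda>v. G (v + 1)) summable_on UNIV"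
    using summable_on_reindex_bij_betw[OF bij, of G] G_sum by simp
  \<comment> \<open>Both sums converge and are equal by translation, so the telescoping series has
    sum 0.\<close>
  then have "(\<Sum>\<^sub>\<infinity>v. G v - G (v + 1)) = (\<Sum>\<^sub>\<infinity>v. G v) - (\<Sum>\<^sub>\<infinity>v. G (v + 1))"
    using infsum_add[OF G_sum summable_on_uminus[THEN iffD2]] by (simp add: infsum_uminus)
  also have "(\<Sum>\<^sub>\<infinity>v. G (v + 1)) = (\<Sum>\<^sub>\<infinity>v. G v)"
    by (rule infsum_reindex_bij_betw[OF bij])
  finally have "pent_sum q (\<lambda>v. (1 + q powi v) * ((usym q v - ?P) * vanish q m v)) = 0"
    by (simp add: diff pent_sum_def)
  \<comment> \<open>The factor \<open>1 + q powi v\<close> is removed by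
    \<open>pent_sum_even\<close>, as the rest is even in \<open>v\<close>.\<close>
  then have 0: "pent_sum q (\<lambda>v. (usym q v - ?P) * vanish q m v) = 0"
    using pent_sum_even[OF assms(1) tu] by (simp add: usym_minus vanish_minus)
  have "vanish q (Suc m) v = vanish q m v + (- ?P) * ((usym q v - ?P) * vanish q m v)" for v
  proof -
    have "?P \<noteq> 0" using assms by simp
    then show ?thesis
      unfolding vanish_Suc[OF assms(1)] using assms(1) by (simp add: algebra_simps)
  qed
  then have "vanish q (Suc m) = (\<lambda>v. vanish q m v + (- ?P) * ((usym q v - ?P) * vanish q m v))"
    by (rule ext)
  then have "pent_sum q (vanish q (Suc m)) =
      pent_sum q (\<lambda>v. vanish q m v + (- ?P) * ((usym q v - ?P) * vanish q m v))"
    by (rule arg_cong)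
  also have "\<dots> = pent_sum q (vanish q m)"
    by (simp only: pent_sum_add[OF t tame_cmult[OF tu]] pent_sum_cmult 0) simp
  finally show ?thesis .
qed

section \<open>Evaluation by letting the block of zeros grow\<close>

lemma LIMSEQ_qpoch_inf:
  assumes "norm q < 1"
  shows "(\<lambda>N. \<Prod>i<N. 1 - q ^ Suc i) \<longlonglongrightarrow> qpoch_inf q q"
proof -
  have "summable (\<lambda>i. norm (q * q ^ i))"
    using assms by (simp add: norm_mult norm_power summable_mult summable_geometric)
  then have "convergent_prod (\<lambda>i. 1 - q * q ^ i)"
    by (intro abs_convergent_prod_imp_convergent_prod summable_imp_abs_convergent_prod) simp
  then have "(\<lambda>n. \<Prod>i\<le>n. 1 - q * q ^ i) \<longlonglongrightarrow> qpoch_inf q q"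
    unfolding qpoch_inf_def by (rule convergent_prod_LIMSEQ)
  then have "(\<lambda>n. \<Prod>i<Suc n. 1 - q ^ Suc i) \<longlonglongrightarrow> qpoch_inf q q"
    by (simp add: lessThan_Suc_atMost)
  then show ?thesis by (rule LIMSEQ_imp_Suc)
qed

text \<open>From \<open>1 + t \<le> exp t\<close> and the geometric series; the bound is uniform in
  \<open>c\<close> and \<open>m\<close>, as dominated convergence requires.\<close>

lemma norm_qprod_le:
  assumes "norm (q :: complex) < 1"
  shows "norm (\<Prod>l<m. 1 - q ^ (c + l)) \<le> exp (1 / (1 - norm q))"
proof -
  have "norm (\<Prod>l<m. 1 - q ^ (c + l)) = (\<Prod>l<m. norm (1 - q ^ (c + l)))"
    by (rule prod_norm[symmetric])
  also have "\<dots> \<le> (\<Prod>l<m. exp (norm q ^ l))"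
  proof (intro prod_mono conjI)
    fix l
    have "norm (1 - q ^ (c + l)) \<le> 1 + norm q ^ (c + l)"
      using norm_triangle_ineq4[of 1 "q ^ (c + l)"] by (simp add: norm_power)
    also have "norm q ^ (c + l) \<le> norm q ^ l"
      using assms by (intro power_decreasing) auto
    also have "1 + norm q ^ l \<le> exp (norm q ^ l)" by simp
    finally show "norm (1 - q ^ (c + l)) \<le> exp (norm q ^ l)" by simp
  qed auto
  also have "\<dots> = exp (\<Sum>l<m. norm q ^ l)" by (simp add: exp_sum)
  also have "\<dots> \<le> exp (\<Sum>l. norm q ^ l)"
    using assms by (simp add: sum_le_suminf summable_geometric)
  also have "(\<Sum>l. norm q ^ l) = 1 / (1 - norm q)"
    using assms by (intro suminf_geometric) simp
  finally show ?thesis .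
qed

lemma tri_nonneg: "0 \<le> tri (int j)"
  by (cases j) (simp_all add: tri_def)

lemma pent_vanish_shift:
  assumes "q \<noteq> 0"
  shows "pent q (int (m + j)) * vanish q m (int (m + j)) =
    (-1) ^ j * q powi (2 * int m * int j + 3 * tri (int j) + int j) *
    ((\<Prod>l<m. 1 - q ^ (j + 1 + l)) * (\<Prod>l<m. 1 - q ^ (m + j + l)))"
proof -
  define N where "N = int (m + j)"
  have 1: "(\<Prod>l<m. 1 - q powi (N - int l)) = (\<Prod>l<m. 1 - q ^ (j + 1 + l))"
  proof -
    have "(\<Prod>l<m. 1 - q powi (N - int l)) = (\<Prod>l<m. 1 - q ^ (j + 1 + (m - Suc l)))"
    proof (intro prod.cong refl)
      fix l assume "l \<in> {..<m}"
      then have "N - int l = int (j + 1 + (m - Suc l))" by (simp add: N_def of_nat_diff)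
      then show "1 - q powi (N - int l) = 1 - q ^ (j + 1 + (m - Suc l))"
        by (simp only: power_int_of_nat)
    qed
    also have "\<dots> = (\<Prod>l<m. 1 - q ^ (j + 1 + l))"
      by (rule prod.nat_diff_reindex)
    finally show ?thesis .
  qed
  have 2: "(\<Prod>l<m. 1 - q powi (- N - int l)) =
      (-1) ^ m * q powi (- (int m * N + tri (int m))) * (\<Prod>l<m. 1 - q ^ (m + j + l))"
  proof -
    have "(\<Prod>l<i. 1 - q powi (- N - int l)) =
      (-1) ^ i * q powi (- (int i * N + tri (int i))) * (\<Prod>l<i. 1 - q ^ (m + j + l))" for i
    proof (induction i)
      case 0
      then show ?case by (simp add: tri_def)
    next
      case (Suc i)
      have "- (int (Suc i) * N + tri (int (Suc i))) = - (int i * N + tri (int i)) + (- N - int i)"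
        using tri_add1[of "int i"] by (simp add: algebra_simps)
      then have "q powi (- (int (Suc i) * N + tri (int (Suc i)))) =
          q powi (- (int i * N + tri (int i))) * q powi (- N - int i)"
        by (simp only: power_int_add[OF disjI1[OF assms]])
      moreover have "1 - q powi (- N - int i) = - (q powi (- N - int i)) * (1 - q ^ (m + j + i))"
      proof -
        have "q powi (- N - int i) * q powi (int (m + j + i)) = 1"
          using assms by (simp add: N_def flip: power_int_add)
        then show ?thesis by (simp only: power_int_of_nat) (simp add: algebra_simps)
      qed
      ultimately show ?case
        by (simp only: prod.lessThan_Suc Suc.IH) (simp add: mult_ac)
    qed
    then show ?thesis by simp
  qed
  have "2 * (3 * tri N + N - (int m * N + tri (int m))) =
      2 * (2 * int m * int j + 3 * tri (int j) + int j)"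
    using two_tri[of N] two_tri[of "int m"] two_tri[of "int j"] by (simp add: N_def algebra_simps)
  then have "(3 * tri N + N) + - (int m * N + tri (int m)) =
      2 * int m * int j + 3 * tri (int j) + int j"
    by simp
  then have 3: "q powi (3 * tri N + N) * q powi (- (int m * N + tri (int m))) =
      q powi (2 * int m * int j + 3 * tri (int j) + int j)"
    using power_int_add[OF disjI1[OF assms], of "3 * tri N + N" "- (int m * N + tri (int m))"] by simp
  have "pent q N * vanish q m N =
      (-1) ^ (m + j) * q powi (3 * tri N + N) *
      ((\<Prod>l<m. 1 - q powi (N - int l)) * (\<Prod>l<m. 1 - q powi (- N - int l)))"
    by (simp only: pent_def vanish_def prod.distrib) (simp only: N_def power_int_of_nat)
  also have "\<dots> = ((-1) ^ (m + j) * (-1) ^ m) *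
      (q powi (3 * tri N + N) * q powi (- (int m * N + tri (int m)))) *
      ((\<Prod>l<m. 1 - q ^ (j + 1 + l)) * (\<Prod>l<m. 1 - q ^ (m + j + l)))"
    unfolding 1 2 by (simp only: mult_ac)
  also have "((-1) ^ (m + j) * (-1) ^ m :: complex) = (-1) ^ j"
    by (simp add: power_add mult_ac flip: power_mult_distrib)
  finally show ?thesis unfolding 3 by (simp only: N_def)
qed

lemma vanish_eq_0:
  assumes "\<bar>v\<bar> < int m"
  shows "vanish q m v = 0"
proof -
  have "(1 - q powi (v - int (nat \<bar>v\<bar>))) * (1 - q powi (- v - int (nat \<bar>v\<bar>))) = 0"
    by (cases "v \<ge> 0") auto
  then show ?thesis
    unfolding vanish_def using assms by (intro prod_zero bexI[of _ "nat \<bar>v\<bar>"]) auto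
qed

text \<open>Only \<open>\<bar>v\<bar> \<ge> m\<close> contributes, and the terms at \<open>v\<close>
  and \<open>-v\<close> differ by the factor \<open>q powi v\<close>. Positive \<open>m\<close>
  keeps the two rays disjoint.\<close>

lemma pent_sum_vanish_sums:
  assumes "q \<noteq> 0" "norm q < 1" "m \<ge> 1"
  shows "(\<lambda>j. pent q (int (m + j)) * vanish q m (int (m + j)) * (1 + q ^ (m + j))) sums
    pent_sum q (vanish q m)"
proof -
  define f where "f v = pent q v * vanish q m v" for v
  have f_sum: "f summable_on A" for A
  proof -
    have "f summable_on UNIV"
      unfolding f_def using tame_vanish_mult[OF assms(1) tame_1[OF assms(1,2)], of m]
      by (intro tame_imp_summable') simp
    then show ?thesis by (rule summable_on_subset_banach) simp
  qed
  have "infsum f UNIV = infsum f ({int m..} \<union> {..- int m})"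
    by (rule infsum_cong_neutral) (auto simp: f_def intro!: vanish_eq_0)
  also have "\<dots> = infsum f {int m..} + infsum f {..- int m}"
    using assms(3) by (intro infsum_Un_disjoint f_sum) auto
  also have "infsum f {int m..} = (\<Sum>\<^sub>\<infinity>j::nat. f (int (m + j)))"
    by (rule infsum_reindex_bij_witness[of _ "\<lambda>j. int (m + j)" "\<lambda>v. nat (v - int m)"]) auto
  also have "infsum f {..- int m} = (\<Sum>\<^sub>\<infinity>j::nat. f (- int (m + j)))"
    by (rule infsum_reindex_bij_witness[of _ "\<lambda>j. - int (m + j)" "\<lambda>v. nat (- v - int m)"]) auto
  finally have eq: "pent_sum q (vanish q m) = (\<Sum>\<^sub>\<infinity>j::nat. f (int (m + j))) + (\<Sum>\<^sub>\<infinity>j::nat. f (- int (m + j)))"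
    by (simp add: pent_sum_def f_def)
  have s1: "(\<lambda>j::nat. f (int (m + j))) summable_on UNIV"
    using f_sum[of "{int m..}"]
    by (subst summable_on_reindex_bij_witness[of _ "\<lambda>v. nat (v - int m)" "\<lambda>j. int (m + j)" "{int m..}" f]) auto
  have s2: "(\<lambda>j::nat. f (- int (m + j))) summable_on UNIV"
    using f_sum[of "{..- int m}"]
    by (subst summable_on_reindex_bij_witness[of _ "\<lambda>v. nat (- v - int m)" "\<lambda>j. - int (m + j)" "{..- int m}" f]) auto
  have "((\<lambda>j::nat. f (int (m + j)) + f (- int (m + j))) has_sum pent_sum q (vanish q m)) UNIV"
    unfolding eq by (intro has_sum_add has_sum_infsum s1 s2)
  then have "(\<lambda>j. f (int (m + j)) + f (- int (m + j))) sums pent_sum q (vanish q m)"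
    by (rule has_sum_imp_sums)
  moreover have "f (int (m + j)) + f (- int (m + j)) =
      pent q (int (m + j)) * vanish q m (int (m + j)) * (1 + q ^ (m + j))" for j
    unfolding f_def pent_minus[OF assms(1)] vanish_minus power_int_of_nat by (simp add: algebra_simps)
  ultimately show ?thesis by simp
qed

text \<open>The sum is independent of \<open>m\<close>, so it may be computed as \<open>m\<close>
  tends to infinity: the term with \<open>j = 0\<close> is the product of the first
  \<open>2 * m\<close> factors of \<open>qpoch_inf q q\<close>, all others tend to 0, and Tannery's
  theorem justifies the exchange. The case \<open>m = 0\<close> is Euler's pentagonal number
  theorem.\<close>

lemma pent_sum_vanish:
  assumes "q \<noteq> 0" "norm q < 1"
  shows "pent_sum q (vanish q m) = qpoch_inf q q"
proof -
  define c where "c = pent_sum q (vanish q 0)"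
  have c: "pent_sum q (vanish q m) = c" for m
    by (induction m) (simp_all add: c_def pent_sum_vanish_step[OF assms])
  define B where "B = exp (1 / (1 - norm q))"
  define a where "a j m = (-1) ^ j * q powi (2 * int m * int j + 3 * tri (int j) + int j) *
    ((\<Prod>l<m. 1 - q ^ (j + 1 + l)) * (\<Prod>l<m. 1 - q ^ (m + j + l))) * (1 + q ^ (m + j))" for j m :: nat
  have a_sum: "(\<Sum>j. a j m) = c" if "m \<ge> 1" for m
    using pent_sum_vanish_sums[OF assms that] unfolding pent_vanish_shift[OF assms(1)] c
    by (simp add: a_def sums_iff)
  \<comment> \<open>Used with \<open>e = m\<close> for the termwise limits and with
    \<open>e = j\<close> for the summable majorant.\<close>
  have bound: "norm (a j m) \<le> 2 * B\<^sup>2 * norm q ^ e" if "int e \<le> 2 * int m * int j + 3 * tri (int j) + int j" for j m e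
  proof -
    have "norm q powi (2 * int m * int j + 3 * tri (int j) + int j) \<le> norm q powi (int e)"
      using assms that by (intro power_int_decreasing) auto
    moreover have "norm (1 + q ^ (m + j)) \<le> 2"
    proof -
      have "norm (1 + q ^ (m + j)) \<le> 1 + norm q ^ (m + j)"
        using norm_triangle_ineq[of 1 "q ^ (m + j)"] by (simp add: norm_power)
      also have "\<dots> \<le> 2" using assms by (simp add: power_le_one)
      finally show ?thesis .
    qed
    ultimately have "norm (a j m) \<le> 1 * norm q ^ e * (B * B) * 2"
      unfolding a_def norm_mult using norm_qprod_le[OF assms(2), of "j + 1" m] norm_qprod_le[OF assms(2), of "m + j" m]
      unfolding B_def
      by (intro mult_mono) (auto simp: norm_power norm_power_int)
    then show ?thesis by (simp add: power2_eq_square mult_ac)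
  qed
  have lim: "a j \<longlonglongrightarrow> (if j = 0 then qpoch_inf q q else 0)" for j
  proof (cases "j = 0")
    case True
    have "a 0 m = (\<Prod>i<2 * m. 1 - q ^ Suc i)" if "m \<ge> 1" for m
    proof -
      obtain m' where m: "m = Suc m'" using \<open>m \<ge> 1\<close> by (cases m) auto
      have "(\<Prod>l<m. 1 - q ^ Suc l) * (\<Prod>l<m. 1 - q ^ (m + l)) =
          (1 - q ^ m) * ((\<Prod>l<m'. 1 - q ^ Suc l) * (\<Prod>l<m. 1 - q ^ Suc (m' + l)))"
        by (simp add: m)
      also have "(\<Prod>l<m'. 1 - q ^ Suc l) * (\<Prod>l<m. 1 - q ^ Suc (m' + l)) = (\<Prod>l<m' + m. 1 - q ^ Suc l)"
        by (induction m) (simp_all add: mult_ac)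
      finally have "a 0 m = ((1 - q ^ m) * (1 + q ^ m)) * (\<Prod>l<m' + m. 1 - q ^ Suc l)"
        by (simp add: a_def tri_def mult_ac)
      \<comment> \<open>The factor \<open>1 - q ^ m\<close> occurs twice in the two products; its
        second copy and \<open>1 + q ^ m\<close> supply the missing factor of index
        \<open>2 * m\<close>.\<close>
      also have "(1 - q ^ m) * (1 + q ^ m) = 1 - q ^ Suc (m' + m)"
        by (simp add: m algebra_simps power_add)
      also have "(1 - q ^ Suc (m' + m)) * (\<Prod>l<m' + m. 1 - q ^ Suc l) = (\<Prod>l<Suc (m' + m). 1 - q ^ Suc l)"
        by simp
      also have "Suc (m' + m) = 2 * m" by (simp add: m)
      finally show ?thesis .
    qed
    then have ev: "\<forall>\<^sub>F m in sequentially. (\<Prod>i<2 * m. 1 - q ^ Suc i) = a 0 m"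
      by (intro eventually_sequentiallyI[of 1]) simp
    have "(\<lambda>m. \<Prod>i<2 * m. 1 - q ^ Suc i) \<longlonglongrightarrow> qpoch_inf q q"
      by (rule filterlim_compose[OF LIMSEQ_qpoch_inf[OF assms(2)]])
        (rule filterlim_subseq, simp add: strict_mono_def)
    then show ?thesis using True Lim_transform_eventually[OF _ ev] by simp
  next
    case False
    have "norm (a j m) \<le> 2 * B\<^sup>2 * norm q ^ m" for m
    proof (rule bound)
      have "int m * 1 \<le> int m * int j" using False by (intro mult_left_mono) auto
      then show "int m \<le> 2 * int m * int j + 3 * tri (int j) + int j"
        using tri_nonneg[of j] by simp
    qed
    moreover have "(\<lambda>m. 2 * B\<^sup>2 * norm q ^ m) \<longlonglongrightarrow> 2 * B\<^sup>2 * 0"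
      using assms by (intro tendsto_intros LIMSEQ_power_zero) simp
    ultimately have "a j \<longlonglongrightarrow> 0"
      by (intro Lim_null_comparison[of "a j" "\<lambda>m. 2 * B\<^sup>2 * norm q ^ m"]) auto
    then show ?thesis using False by simp
  qed
  have "(\<lambda>m. \<Sum>j. a j m) \<longlonglongrightarrow> (\<Sum>j. if j = 0 then qpoch_inf q q else 0)"
  proof -
    have "\<forall>\<^sub>F (j, m) in at_top \<times>\<^sub>F sequentially. norm (a j m) \<le> 2 * B\<^sup>2 * norm q ^ j"
    proof (rule always_eventually, clarify)
      fix j m
      show "norm (a j m) \<le> 2 * B\<^sup>2 * norm q ^ j"
        by (rule bound) (use tri_nonneg[of j] in simp)
    qed
    moreover have "summable (\<lambda>j. 2 * B\<^sup>2 * norm q ^ j)"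
      using assms by (intro summable_mult summable_geometric) simp
    ultimately show ?thesis
      using tannerys_theorem[of a, OF lim] by simp
  qed
  moreover have "(\<Sum>j. if j = 0 then qpoch_inf q q else 0) = qpoch_inf q q"
    using sums_single[of 0 "\<lambda>_. qpoch_inf q q"] by (simp add: sums_iff)
  moreover have "(\<lambda>m. \<Sum>j. a j m) \<longlonglongrightarrow> c"
    by (rule Lim_transform_eventually[OF tendsto_const]) (use a_sum in \<open>auto intro!: eventually_sequentiallyI[of 1]\<close>)
  ultimately have "c = qpoch_inf q q" using LIMSEQ_unique by metis
  then show ?thesis using c by simp
qed

lemma pent_sum_vanish_poly:
  assumes "q \<noteq> 0" "norm q < 1"
  shows "pent_sum q (\<lambda>v. vanish q m v * poly f (usym q v)) =
    qpoch_inf q q * poly (hermite_mean (1 / q) f) ((1 / q) ^ m)"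
proof (induction "degree f" arbitrary: f m)
  case 0
  then obtain c where "f = [:c:]" by (metis degree_eq_zeroE)
  then show ?case
    using pent_sum_cmult[of q c "vanish q m"] by (simp add: mult.commute pent_sum_vanish assms)
next
  case (Suc d)
  define P y0 where "P = (1 / q) ^ m" and "y0 = P + 1 / P"
  define g where "g = synthetic_div f y0"
  have P: "P \<noteq> 0" using assms by (simp add: P_def)
  have f: "f = [:-y0, 1:] * g + [:poly f y0:]"
    unfolding g_def by (rule synthetic_div_correct'[symmetric])
  have "d = degree g" using Suc.hyps(2) by (simp add: g_def degree_synthetic_div)
  note IH = Suc.hyps(1)[OF this, of "Suc m"]
  have t: "tame q (\<lambda>v. vanish q i v * poly h (usym q v))" for i h
    using tame_vanish_mult[OF assms(1) tame_poly[OF assms(1) tame_1[OF assms]], of i h] by simp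
  have "vanish q m v * poly f (usym q v) = poly f y0 * (vanish q m v * poly 1 (usym q v)) +
      (- 1 / P) * (vanish q (Suc m) v * poly g (usym q v))" for v
  proof -
    have pf: "poly f (usym q v) = (usym q v - y0) * poly g (usym q v) + poly f y0"
      by (subst (1) f) (simp add: algebra_simps)
    have vs: "vanish q (Suc m) v = vanish q m v * (- P * (usym q v - y0))"
      unfolding vanish_Suc[OF assms(1)] by (simp add: P_def y0_def)
    show ?thesis unfolding pf vs using P by (simp add: field_simps)
  qed
  then have "pent_sum q (\<lambda>v. vanish q m v * poly f (usym q v)) =
      poly f y0 * pent_sum q (\<lambda>v. vanish q m v * poly 1 (usym q v)) +
      (- 1 / P) * pent_sum q (\<lambda>v. vanish q (Suc m) v * poly g (usym q v))"
    by (simp only: pent_sum_add[OF tame_cmult[OF t] tame_cmult[OF t]] pent_sum_cmult)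
  also have "\<dots> = qpoch_inf q q * (poly f y0 + (- 1 / P) * poly (hermite_mean (1 / q) g) (1 / q * P))"
    unfolding IH by (simp add: pent_sum_vanish assms P_def algebra_simps)
  also have "poly f y0 + (- 1 / P) * poly (hermite_mean (1 / q) g) (1 / q * P) =
      poly (hermite_mean (1 / q) f) P"
    using hermite_mean_linear_factor[OF P, of "1 / q" g]
    by (subst (2) f) (simp add: hermite_mean_add y0_def)
  finally show ?case by (simp only: P_def)
qed

lemma pent_sum_orth_char_poly:
  assumes "q \<noteq> 0" "norm q < 1"
  shows "pent_sum q (\<lambda>v. 1 / (q powi v) ^ m * poly f (usym q v)) =
    qpoch_inf q q * poly (hermite_mean (1 / q) (orth_char m * f)) 1"
  using pent_sum_orth_char[OF assms, of m f] pent_sum_vanish_poly[OF assms, of 0 "orth_char m * f"]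
  by (simp add: vanish_def)

section \<open>The multiple sum\<close>

lemma has_sum_prod_PiE:
  fixes f :: "'a \<Rightarrow> int \<Rightarrow> complex"
  assumes "finite A" and f: "\<And>i. i \<in> A \<Longrightarrow> (\<lambda>v. norm (f i v)) summable_on UNIV"
  shows "((\<lambda>g. \<Prod>i\<in>A. f i (g i)) has_sum (\<Prod>i\<in>A. infsum (f i) UNIV)) (A \<rightarrow>\<^sub>E UNIV)"
proof -
  have "Infinite_Set_Sum.abs_summable_on (\<lambda>g. \<Prod>i\<in>A. f i (g i)) (A \<rightarrow>\<^sub>E UNIV)"
    using assms by (intro abs_summable_on_prod_PiE) (auto simp flip: abs_summable_equivalent)
  then have "(\<lambda>g. \<Prod>i\<in>A. f i (g i)) summable_on (A \<rightarrow>\<^sub>E UNIV)"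
    unfolding abs_summable_equivalent[symmetric] by (rule Infinite_Sum.abs_summable_summable)
  moreover have "infsum (\<lambda>g. \<Prod>i\<in>A. f i (g i)) (A \<rightarrow>\<^sub>E UNIV) = (\<Prod>i\<in>A. infsum (f i) UNIV)"
    using assms by (intro infsum_prod_PiE_abs)
  ultimately show ?thesis by (simp add: has_sum_infsum flip: \<open>infsum _ _ = _\<close>)
qed

text \<open>For one monomial the variables separate, and each one-variable sum is given by
  \<open>pent_sum_orth_char_poly\<close>. Tameness supplies the absolute convergence that the
  product formula needs.\<close>

lemma has_sum_pent_monomial_sum:
  assumes "q \<noteq> 0" "norm q < 1"
  shows "((\<lambda>v. (\<Prod>m<n. pent q (v m) * (1 / (q powi v m) ^ m)) * monomial_sum n xs (\<lambda>m. usym q (v m))) has_sum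
    (qpoch_inf q q ^ n * poly (tensor_mean (1 / q) n orth_char xs) 1)) ({..<n} \<rightarrow>\<^sub>E UNIV)"
proof (induction xs)
  case Nil
  then show ?case by simp
next
  case (Cons x xs)
  define f where "f m = (\<lambda>v. pent q v * (1 / (q powi v) ^ m * poly (monom 1 (snd x m)) (usym q v)))" for m
  have "infsum (f m) UNIV =
      qpoch_inf q q * poly (hermite_mean (1 / q) (orth_char m * monom 1 (snd x m))) 1" for m
    using pent_sum_orth_char_poly[OF assms, of m "monom 1 (snd x m)"]
    by (simp only: pent_sum_def f_def)
  moreover have "(\<lambda>v. norm (f m v)) summable_on UNIV" for m
  proof -
    have "tame q (\<lambda>v. q powi (- int m * v) * (1 * poly (monom 1 (snd x m)) (usym q v)))"
      by (intro tame_powi tame_poly tame_1 assms)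
    moreover have "q powi (- int m * v) = 1 / (q powi v) ^ m" for v
      by (simp add: power_int_minus power_int_mult power_int_power field_simps mult.commute
        flip: power_int_of_nat)
    ultimately show ?thesis
      unfolding f_def by (intro tame_imp_summable) simp
  qed
  ultimately have "((\<lambda>g. \<Prod>m<n. f m (g m)) has_sum
      (\<Prod>m<n. qpoch_inf q q * poly (hermite_mean (1 / q) (orth_char m * monom 1 (snd x m))) 1))
      ({..<n} \<rightarrow>\<^sub>E UNIV)"
    using has_sum_prod_PiE[of "{..<n}" f] by simp
  note sum = has_sum_add[OF has_sum_cmult_right[OF this, of "fst x"] Cons.IH]
  have "(\<Prod>m<n. f m (g m)) =
      (\<Prod>m<n. pent q (g m) * (1 / (q powi g m) ^ m)) * (\<Prod>m<n. usym q (g m) ^ snd x m)" for g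
    unfolding f_def by (simp only: poly_monom mult_1 mult.assoc prod.distrib)
  then have "fst x * (\<Prod>m<n. f m (g m)) +
      (\<Prod>m<n. pent q (g m) * (1 / (q powi g m) ^ m)) * monomial_sum n xs (\<lambda>m. usym q (g m)) =
      (\<Prod>m<n. pent q (g m) * (1 / (q powi g m) ^ m)) * monomial_sum n (x # xs) (\<lambda>m. usym q (g m))" for g
    by (simp only: monomial_sum_Cons distrib_left mult.left_commute)
  moreover have "fst x * (\<Prod>m<n. qpoch_inf q q * poly (hermite_mean (1 / q) (orth_char m * monom 1 (snd x m))) 1) +
      qpoch_inf q q ^ n * poly (tensor_mean (1 / q) n orth_char xs) 1 =
      qpoch_inf q q ^ n * poly (tensor_mean (1 / q) n orth_char (x # xs)) 1"
    by (simp add: prod.distrib poly_prod distrib_left mult.left_commute)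
  ultimately show ?case using sum by (simp only:)
qed

section \<open>Rewriting the summand and the limiting configuration\<close>

lemma power_int_sum:
  assumes "finite A" "(x :: complex) \<noteq> 0"
  shows "x powi (\<Sum>i\<in>A. f i) = (\<Prod>i\<in>A. x powi f i)"
  using assms(1) by (induction rule: finite_induct) (simp_all add: power_int_add assms(2))

text \<open>Both quotients are finite products of \<open>2 * k - 1\<close> factors. The factor of
  index \<open>-r\<close> in the first times that of index \<open>r\<close> in the second is
  \<open>q powi a\<close> times a linear factor of \<open>pair_factor\<close>.\<close>

lemma qpoch_quot_pair:
  assumes "q \<noteq> 0" "k \<ge> 1"
  shows "qpoch_quot q (a - b + 1 - int k) (a - b + int k) *
      qpoch_quot q (a + b + 1 - int k) (a + b + int k) =
    (q powi a) ^ (2 * k - 1) * pair_factor q k (usym q a) (usym q b)"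
proof -
  let ?I = "{1 - int k..int k - 1}"
  have quot: "qpoch_quot q (c + 1 - int k) (c + int k) = (\<Prod>r\<in>?I. 1 - q powi (c + r))" for c
  proof -
    have "qpoch_quot q (c + 1 - int k) (c + int k) =
        (\<Prod>r<2 * k - 1. 1 - q powi (c + 1 - int k) * q ^ r)"
    proof -
      have "nat (c + int k - (c + 1 - int k)) = 2 * k - 1" using assms by simp
      moreover have "c + 1 - int k \<le> c + int k" using assms by simp
      ultimately show ?thesis by (simp add: qpoch_quot_def)
    qed
    also have "\<dots> = (\<Prod>r\<in>?I. 1 - q powi (c + r))"
    proof (rule prod.reindex_bij_witness[of _ "\<lambda>r. nat (r + int k - 1)" "\<lambda>i. int i + 1 - int k"])
      fix i assume "i \<in> {..<2 * k - 1}"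
      have "c + (int i + 1 - int k) = (c + 1 - int k) + int i" by simp
      then have "q powi (c + (int i + 1 - int k)) = q powi (c + 1 - int k) * q powi (int i)"
        by (simp only: power_int_add[OF disjI1[OF assms(1)]])
      then show "1 - q powi (c + (int i + 1 - int k)) = 1 - q powi (c + 1 - int k) * q ^ i"
        by simp
    qed (use assms in auto)
    finally show ?thesis .
  qed
  have "(\<Prod>r\<in>?I. 1 - q powi (a - b + r)) = (\<Prod>r\<in>?I. 1 - q powi (a - b - r))"
    by (rule prod.reindex_bij_witness[of _ uminus uminus]) auto
  then have "qpoch_quot q (a - b + 1 - int k) (a - b + int k) *
      qpoch_quot q (a + b + 1 - int k) (a + b + int k) =
      (\<Prod>r\<in>?I. (1 - q powi (a - b - r)) * (1 - q powi (a + b + r)))"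
    unfolding quot by (simp only: prod.distrib)
  also have "\<dots> = (\<Prod>r\<in>?I. q powi a * (usym q a - q powi r * q powi b - 1 / (q powi r * q powi b)))"
  proof (intro prod.cong refl)
    fix r
    define x z t where "x = q powi a" and "z = q powi b" and "t = q powi r"
    have nz: "x \<noteq> 0" "z \<noteq> 0" "t \<noteq> 0" using assms by (auto simp: x_def z_def t_def)
    have "q powi (a - b - r) = x / (z * t)" "q powi (a + b + r) = x * z * t"
      using assms by (simp_all add: x_def z_def t_def power_int_add power_int_diff)
    moreover have "(1 - x / (z * t)) * (1 - x * z * t) = x * (x + 1 / x - t * z - 1 / (t * z))"
      using nz by (simp add: field_simps)
    ultimately show "(1 - q powi (a - b - r)) * (1 - q powi (a + b + r)) =
        q powi a * (usym q a - q powi r * q powi b - 1 / (q powi r * q powi b))"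
      by (simp only: usym_def x_def z_def t_def)
  qed
  also have "\<dots> = (q powi a) ^ card ?I * pair_factor q k (usym q a) (usym q b)"
    using assms pair_factor_prod[of q "q powi a" "q powi b" k]
    by (simp add: prod.distrib usym_def)
  also have "card ?I = 2 * k - 1" using assms by simp
  finally show ?thesis .
qed

text \<open>The substitution \<open>m = n - i\<close>, \<open>l = n - j\<close> turns
  \<open>i < j\<close> into \<open>l < m\<close>.\<close>

lemma prod_index_pairs:
  "(\<Prod>(i, j)\<in>index_pairs n. F i j) = (\<Prod>m<n. \<Prod>l<m. F (n - m) (n - l))"
proof -
  have "(\<Prod>m<n. \<Prod>l<m. F (n - m) (n - l)) = (\<Prod>(m, l)\<in>(SIGMA m:{..<n}. {..<m}). F (n - m) (n - l))"
    by (rule prod.Sigma) auto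
  also have "\<dots> = (\<Prod>(i, j)\<in>index_pairs n. F i j)"
    by (rule prod.reindex_bij_witness[of _ "\<lambda>(i, j). (n - i, n - j)" "\<lambda>(m, l). (n - m, n - l)"])
      (auto simp: index_pairs_def)
  finally show ?thesis by simp
qed

lemma prod_atLeastAtMost_rev: "(\<Prod>i=1..n. F i) = (\<Prod>m<n. F (n - m :: nat))"
  by (rule prod.reindex_bij_witness[of _ "\<lambda>m. n - m" "\<lambda>i. n - i"]) auto

text \<open>Writing \<open>p ^ N - p ^ l = p ^ l * (p ^ (N - l) - 1)\<close> and reversing the order
  cancels the denominators; the two powers \<open>p ^ l\<close> cancel \<open>p ^ (2 * l)\<close>,
  and a sign remains for each factor.\<close>

lemma weight_limit_eq:
  assumes "norm p > 1"
  shows "weight_limit p N * (\<Prod>l<N. p ^ N - p ^ l) * (\<Prod>l<N. p ^ l) = (-1) ^ N"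
proof -
  have p: "p \<noteq> 0" "p ^ Suc l \<noteq> 1" for l
    using assms power_inj_norm[of p "Suc l" 0] by auto
  have "(\<Prod>l<N. p ^ N - p ^ l) = (\<Prod>l<N. p ^ l * (p ^ Suc (N - Suc l) - 1))"
  proof (intro prod.cong refl)
    fix l assume "l \<in> {..<N}"
    then have "p ^ N = p ^ l * p ^ Suc (N - Suc l)" by (simp flip: power_add power_Suc)
    then show "p ^ N - p ^ l = p ^ l * (p ^ Suc (N - Suc l) - 1)" by (simp add: algebra_simps)
  qed
  also have "\<dots> = (\<Prod>l<N. p ^ l) * (\<Prod>l<N. p ^ Suc l - 1)"
    unfolding prod.distrib by (subst prod.nat_diff_reindex[of "\<lambda>l. p ^ Suc l - 1"]) simp
  finally have "weight_limit p N * (\<Prod>l<N. p ^ N - p ^ l) * (\<Prod>l<N. p ^ l) =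
      (\<Prod>l<N. - 1 / (p ^ (2 * l) * (p ^ Suc l - 1)) * (p ^ l * (p ^ Suc l - 1)) * p ^ l)"
    unfolding weight_limit_def by (simp only: prod.distrib mult_ac)
  also have "\<dots> = (\<Prod>l<N. - 1)"
  proof (intro prod.cong refl)
    fix l
    have "p ^ Suc l - 1 \<noteq> 0" using p by simp
    moreover have "p ^ (2 * l) = p ^ l * p ^ l" by (simp add: mult_2 power_add)
    ultimately show "- 1 / (p ^ (2 * l) * (p ^ Suc l - 1)) * (p ^ l * (p ^ Suc l - 1)) * p ^ l = - 1"
      using p by simp
  qed
  finally show ?thesis by simp
qed

text \<open>The extra \<open>u - w\<close>, supplied later by the monic polynomials, lets both
  products start at \<open>r = 0\<close>.\<close>

lemma pair_lead_eq:
  assumes "k \<ge> 1"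
  shows "(u - w) * pair_lead p k u w = (\<Prod>r<k. u - p ^ r * w) * (\<Prod>r<k. u - w / p ^ r)"
proof -
  have "{..<k} = insert 0 {1..<k}" using assms by auto
  then have "(\<Prod>r<k. F r) = F 0 * (\<Prod>r=1..<k. F r)" for F :: "nat \<Rightarrow> complex"
    by simp
  then show ?thesis by (simp add: pair_lead_def prod.distrib mult_ac)
qed

lemma tri_Suc_add_tri: "tri (N + 1) + tri N = N * N"
  using two_tri[of N] unfolding tri_add1 right_diff_distrib by linarith

text \<open>With \<open>N = k * m\<close>, the first products of \<open>pair_lead_eq\<close> run
  over all exponents below \<open>N\<close> and cancel the weight through
  \<open>weight_limit_eq\<close>. The second ones give \<open>p ^ (N * N)\<close> times the wanted
  product, and the remaining powers cancel because
  \<open>tri (N + 1) + tri N = N * N\<close>.\<close>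

lemma spread_limit_factor:
  assumes q: "q \<noteq> 0" "norm q < 1" and k: "k \<ge> 1" and p: "p = 1 / q"
  shows "(-1) ^ (k * m) * q powi tri (int (k * m) + 1) * (weight_limit p (k * m) *
      (\<Prod>l<m. p ^ (k * m) - p ^ (k * l)) * (\<Prod>l<m. pair_lead p k (p ^ (k * m)) (p ^ (k * l)))) =
    (\<Prod>l<m. \<Prod>r<k. 1 - q ^ (k * (m - l) + r))"
proof -
  define N where "N = k * m"
  have p1: "norm p > 1" using q by (simp add: p norm_divide)
  have p0: "p \<noteq> 0" using q by (simp add: p)
  let ?D = "\<Prod>l<N. p ^ N - p ^ l"
  \<comment> \<open>The exponents \<open>k * l + r\<close> with \<open>l < m\<close> and
    \<open>r < k\<close> are exactly those below \<open>N\<close>, grouped in blocks of length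
    \<open>k\<close>.\<close>
  have D: "(\<Prod>l<m. \<Prod>r<k. p ^ N - p ^ r * p ^ (k * l)) = ?D"
  proof -
    have "(\<Prod>r<k. p ^ N - p ^ r * p ^ (k * l)) = (\<Prod>r=l * k..<l * k + k. p ^ N - p ^ r)" for l
      by (rule prod.reindex_bij_witness[of _ "\<lambda>r. r - l * k" "\<lambda>r. r + l * k"])
        (auto simp: power_add mult.commute)
    then show ?thesis by (simp add: prod.nat_group N_def mult.commute)
  qed
  have "p ^ N - p ^ (k * l) / p ^ r = p ^ N * (1 - q ^ (k * (m - l) + r))" if "l < m" for l r
  proof -
    have "N = k * l + k * (m - l)"
      using that by (simp add: N_def flip: distrib_left)
    then have "p ^ N * q ^ (k * (m - l)) = p ^ (k * l)"
      using q by (simp add: p power_add power_one_over)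
    moreover have "q ^ r = 1 / p ^ r" using q by (simp add: p power_one_over)
    ultimately show ?thesis by (simp add: power_add algebra_simps)
  qed
  then have "(\<Prod>l<m. \<Prod>r<k. p ^ N - p ^ (k * l) / p ^ r) =
      (\<Prod>l<m. \<Prod>r<k. p ^ N * (1 - q ^ (k * (m - l) + r)))"
    by (intro prod.cong refl) auto
  also have "\<dots> = p ^ (N * N) * (\<Prod>l<m. \<Prod>r<k. 1 - q ^ (k * (m - l) + r))"
    by (simp add: prod.distrib N_def mult_ac flip: power_mult)
  finally have E: "(\<Prod>l<m. \<Prod>r<k. p ^ N - p ^ (k * l) / p ^ r) =
      p ^ (N * N) * (\<Prod>l<m. \<Prod>r<k. 1 - q ^ (k * (m - l) + r))" (is "_ = _ * ?R") .
  have "(\<Prod>l<m. p ^ N - p ^ (k * l)) * (\<Prod>l<m. pair_lead p k (p ^ N) (p ^ (k * l))) =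
      ?D * (p ^ (N * N) * ?R)"
    unfolding prod.distrib[symmetric] pair_lead_eq[OF k] unfolding prod.distrib D E ..
  moreover have "(\<Prod>l<N. p ^ l) = p powi tri (int N)"
  proof (induction N)
    case (Suc N)
    have "tri (int (Suc N)) = tri (int N) + int N" using tri_add1[of "int N"] by (simp add: add.commute)
    then have "p powi tri (int (Suc N)) = p powi tri (int N) * p ^ N"
      using p0 by (simp add: power_int_add)
    with Suc show ?case by simp
  qed (simp add: tri_def)
  moreover have "q powi tri (int N + 1) * p ^ (N * N) = p powi tri (int N)"
  proof -
    have "q powi tri (int N + 1) = p powi ((-1) * tri (int N + 1))"
      unfolding power_int_mult by (simp add: p)
    then have "q powi tri (int N + 1) = p powi (- tri (int N + 1))" by simp
    moreover have "p ^ (N * N) = p powi (int N * int N)"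
      by (simp flip: of_nat_mult)
    ultimately have "q powi tri (int N + 1) * p ^ (N * N) = p powi (- tri (int N + 1) + int N * int N)"
      by (simp only: power_int_add[OF disjI1[OF p0]])
    moreover have "- tri (int N + 1) + int N * int N = tri (int N)"
      using tri_Suc_add_tri[of "int N"] by simp
    ultimately show ?thesis by (simp only:)
  qed
  ultimately have "(-1) ^ N * q powi tri (int N + 1) * (weight_limit p N *
      (\<Prod>l<m. p ^ N - p ^ (k * l)) * (\<Prod>l<m. pair_lead p k (p ^ N) (p ^ (k * l)))) =
      (-1) ^ N * (weight_limit p N * ?D * (\<Prod>l<N. p ^ l)) * ?R"
    by (simp add: mult_ac)
  also have "\<dots> = ((-1) ^ N * (-1) ^ N) * ?R"
    unfolding weight_limit_eq[OF p1] ..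
  also have "((-1) ^ N * (-1) ^ N :: complex) = 1"
    by (simp flip: power_mult_distrib)
  finally show ?thesis by (simp add: N_def)
qed

text \<open>The contributions \<open>-k (i - 1)\<close> and \<open>k (n - 1)\<close> to the
  coefficient of \<open>\<mu> i\<close> add up to \<open>k (n - i)\<close>.\<close>

lemma weight_eq_prod:
  fixes q :: complex
  assumes "q \<noteq> 0"
  shows "(-1) powi vsize n \<mu> * q powi (- int k * nstat n \<mu> + 3 * nstat_conj n \<mu>
      + vsize n \<mu> * (int k * (int n - 1) + 1)) =
    (\<Prod>i=1..n. (-1) powi \<mu> i * q powi (3 * tri (\<mu> i) + \<mu> i * (1 + int k * (int n - int i))))"
proof -
  have "- int k * nstat n \<mu> + 3 * nstat_conj n \<mu> + vsize n \<mu> * (int k * (int n - 1) + 1) =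
      (\<Sum>i=1..n. - int k * ((int i - 1) * \<mu> i) + 3 * tri (\<mu> i) + \<mu> i * (int k * (int n - 1) + 1))"
    by (simp only: nstat_def nstat_conj_def vsize_def tri_def sum_distrib_left sum_distrib_right sum.distrib)
  also have "\<dots> = (\<Sum>i=1..n. 3 * tri (\<mu> i) + \<mu> i * (1 + int k * (int n - int i)))"
    by (intro sum.cong refl) (simp add: algebra_simps)
  finally have "q powi (- int k * nstat n \<mu> + 3 * nstat_conj n \<mu> + vsize n \<mu> * (int k * (int n - 1) + 1)) =
      (\<Prod>i=1..n. q powi (3 * tri (\<mu> i) + \<mu> i * (1 + int k * (int n - int i))))"
    by (simp only: power_int_sum[OF finite_atLeastAtMost assms])
  moreover have "(-1 :: complex) powi vsize n \<mu> = (\<Prod>i=1..n. (-1) powi \<mu> i)"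
    unfolding vsize_def by (rule power_int_sum) auto
  ultimately show ?thesis by (simp only: prod.distrib)
qed

text \<open>After the shift by \<open>k * m\<close>, the powers released by the \<open>m\<close>
  pair factors of index \<open>m\<close> complete the quadratic exponent to the pentagonal one, up
  to a constant and the factor \<open>1 / (q powi v) ^ m\<close>.\<close>

lemma shifted_weight:
  fixes q :: complex
  assumes "q \<noteq> 0" "k \<ge> 1"
  shows "(-1) powi (v - int (k * m)) * q powi (3 * tri (v - int (k * m)) + (v - int (k * m)) * (1 + int k * int m)) *
      ((q powi v) ^ (2 * k - 1)) ^ m =
    (-1) ^ (k * m) * q powi tri (int (k * m) + 1) * (pent q v * (1 / (q powi v) ^ m))"
proof -
  define N where "N = int k * int m"
  have "((q powi v) ^ (2 * k - 1)) ^ m * (q powi v) ^ m = q powi ((2 * N) * v)"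
  proof -
    have "(2 * k - 1) * m + m = 2 * (k * m)" using assms(2) by (cases k) simp_all
    then have "((q powi v) ^ (2 * k - 1)) ^ m * (q powi v) ^ m = (q powi v) ^ (2 * (k * m))"
      by (simp flip: power_mult power_add)
    also have "\<dots> = (q powi v) powi (2 * N)" by (simp add: N_def flip: power_int_of_nat)
    finally show ?thesis by (simp add: mult.commute flip: power_int_mult)
  qed
  then have 1: "((q powi v) ^ (2 * k - 1)) ^ m = q powi ((2 * N) * v) * (1 / (q powi v) ^ m)"
    using assms by (simp add: field_simps)
  have "2 * (3 * tri (v - N) + (v - N) * (1 + N) + (2 * N) * v) = 2 * (tri (N + 1) + (3 * tri v + v))"
    using two_tri[of "v - N"] two_tri[of v] two_tri[of "N + 1"] by (simp add: algebra_simps)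
  then have "(3 * tri (v - N) + (v - N) * (1 + N)) + (2 * N) * v = tri (N + 1) + (3 * tri v + v)"
    by simp
  then have 2: "q powi (3 * tri (v - N) + (v - N) * (1 + N)) * q powi ((2 * N) * v) =
      q powi tri (N + 1) * q powi (3 * tri v + v)"
    by (simp only: power_int_add[OF disjI1[OF assms(1)], symmetric])
  have 3: "(-1 :: complex) powi (v - N) = (-1) ^ (k * m) * (-1) powi v"
  proof -
    have "(-1 :: complex) powi N = (-1) ^ (k * m)"
      by (simp add: N_def flip: of_nat_mult)
    moreover have "((-1) ^ (k * m) * (-1) ^ (k * m) :: complex) = 1"
      by (simp flip: power_mult_distrib)
    ultimately show ?thesis by (simp add: power_int_diff field_simps)
  qed
  have "(-1) powi (v - N) * q powi (3 * tri (v - N) + (v - N) * (1 + N)) *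
      (q powi ((2 * N) * v) * (1 / (q powi v) ^ m)) =
      (-1) powi (v - N) * (q powi (3 * tri (v - N) + (v - N) * (1 + N)) * q powi ((2 * N) * v)) *
      (1 / (q powi v) ^ m)"
    by (simp only: mult_ac)
  also have "\<dots> = (-1) ^ (k * m) * q powi tri (N + 1) * (pent q v * (1 / (q powi v) ^ m))"
    unfolding 2 3 pent_def by (simp only: mult_ac)
  finally show ?thesis unfolding 1 of_nat_mult by (simp only: N_def)
qed

theorem lemma4p11:
  fixes n k :: nat and q :: complex
  assumes "n \<ge> 1" and "0 < norm q" and "norm q < 1"
  shows "((\<lambda>\<mu>. (-1) powi vsize n \<mu>
            * q powi (- int k * nstat n \<mu> + 3 * nstat_conj n \<mu>
                      + vsize n \<mu> * (int k * (int n - 1) + 1))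
            * prod_exc k 1
                (\<lambda>(i, j).
                   qpoch_quot q (1 + int k * (int j - int i - 1) + \<mu> i - \<mu> j)
                                (int k * (int j - int i + 1) + \<mu> i - \<mu> j)
                 * qpoch_quot q (1 + int k * (2 * int n - 1 - int i - int j) + \<mu> i + \<mu> j)
                                (int k * (2 * int n + 1 - int i - int j) + \<mu> i + \<mu> j))
                (index_pairs n))
          has_sum
          (qpoch_inf q q ^ n
            * prod_exc k 1
                (\<lambda>(i, j). qpoch_quot q (int k * (int j - int i)) (int k * (int j - int i + 1)))
                (index_pairs n)))
         (int_vecs n)"
proof (cases "k = 0")
  case True
  have q: "q \<noteq> 0" using assms by auto
  \<comment> \<open>For \<open>k = 0\<close> both exceptional products are 1, and the sum is a
    product of \<open>n\<close> pentagonal series.\<close>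
  have "infsum (pent q) UNIV = qpoch_inf q q"
    using pent_sum_vanish[OF q assms(3), of 0] by (simp add: pent_sum_def vanish_def)
  moreover have "(\<lambda>v. norm (pent q v)) summable_on UNIV"
    using tame_imp_summable[OF tame_1[OF q assms(3)]] by simp
  ultimately have "((\<lambda>\<mu>. \<Prod>i=1..n. pent q (\<mu> i)) has_sum qpoch_inf q q ^ n) (int_vecs n)"
    using has_sum_prod_PiE[of "{1..n}" "\<lambda>_. pent q"] by (simp add: int_vecs_def)
  then show ?thesis
    unfolding weight_eq_prod[OF q] by (simp add: True prod_exc_def pent_def)
next
  case False
  then have k: "k \<ge> 1" by simp
  have q: "q \<noteq> 0" using assms by auto
  define p where "p = 1 / q"
  have p: "norm p > 1" using assms q by (simp add: p_def norm_divide)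
  \<comment> \<open>\<open>C\<close> collects the constants produced by
    \<open>shifted_weight\<close>; multiplied by \<open>spread_limit\<close>, it gives the product
    over pairs in the evaluation.\<close>
  define C where "C = (\<Prod>m<n. (-1) ^ (k * m) * q powi tri (int (k * m) + 1))"
  define h where "h v = C * ((\<Prod>m<n. pent q (v m) * (1 / (q powi v m) ^ m)) *
      pair_prod q k n (\<lambda>m. usym q (v m)))" for v
  obtain xs where xs: "\<And>u. pair_prod q k n u = monomial_sum n xs u"
    using polyfun_pair_prod[of n q k] unfolding polyfun_def by blast
  have pq: "pair_prod p k n u = pair_prod q k n u" for u
    by (simp only: pair_prod_def p_def pair_factor_inverse)
  have "poly (tensor_mean p n orth_char xs) 1 = spread_limit p k n"
    by (rule tensor_mean_monic[OF p k]) (simp_all add: orth_char_monic pq xs)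
  then have sum: "(h has_sum C * (qpoch_inf q q ^ n * spread_limit p k n)) ({..<n} \<rightarrow>\<^sub>E UNIV)"
    using has_sum_cmult_right[OF has_sum_pent_monomial_sum[OF q assms(3), of n xs], of C]
    unfolding h_def xs by (simp only: p_def)
  have C: "C * spread_limit p k n = prod_exc k 1
      (\<lambda>(i, j). qpoch_quot q (int k * (int j - int i)) (int k * (int j - int i + 1))) (index_pairs n)"
  proof -
    have "C * spread_limit p k n = (\<Prod>m<n. \<Prod>l<m. \<Prod>r<k. 1 - q ^ (k * (m - l) + r))"
      unfolding C_def spread_limit_def prod.distrib[symmetric]
      by (intro prod.cong refl spread_limit_factor[OF q assms(3) k p_def])
    also have "\<dots> = (\<Prod>m<n. \<Prod>l<m. qpoch_quot q (int k * (int (n - l) - int (n - m)))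
        (int k * (int (n - l) - int (n - m) + 1)))"
    proof (intro prod.cong refl)
      fix m l assume "m \<in> {..<n}" "l \<in> {..<m}"
      then have "int k * (int (n - l) - int (n - m)) = int (k * (m - l))"
        "int k * (int (n - l) - int (n - m) + 1) = int (k * (m - l)) + int k"
        by (simp_all add: of_nat_diff algebra_simps)
      then show "(\<Prod>r<k. 1 - q ^ (k * (m - l) + r)) = qpoch_quot q (int k * (int (n - l) - int (n - m)))
        (int k * (int (n - l) - int (n - m) + 1))"
        by (simp add: qpoch_quot_def power_add del: of_nat_mult)
    qed
    finally show ?thesis using False by (simp add: prod_exc_def prod_index_pairs)
  qed
  show ?thesis
  \<comment> \<open>The bijection is \<open>v m = \<mu> (n - m) + k * m\<close>: reversal of the
    indices together with the shift that symmetrizes the quotients.\<close>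
  proof (subst has_sum_reindex_bij_witness[of "int_vecs n"
      "\<lambda>v. restrict (\<lambda>i. v (n - i) - int (k * (n - i))) {1..n}"
      "\<lambda>\<mu>. restrict (\<lambda>m. \<mu> (n - m) + int (k * m)) {..<n}" "{..<n} \<rightarrow>\<^sub>E UNIV" h])
    fix \<mu> :: "nat \<Rightarrow> int" assume \<mu>: "\<mu> \<in> int_vecs n"
    define v where "v = restrict (\<lambda>m. \<mu> (n - m) + int (k * m)) {..<n}"
    show "restrict (\<lambda>i. v (n - i) - int (k * (n - i))) {1..n} = \<mu>"
      using \<mu> by (auto simp: v_def int_vecs_def PiE_iff extensional_def fun_eq_iff)
    show "v \<in> {..<n} \<rightarrow>\<^sub>E UNIV" by (simp add: v_def)
    have v: "\<mu> (n - m) = v m - int (k * m)" if "m < n" for m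
      using that by (simp add: v_def)
    have 1: "(-1) powi vsize n \<mu> * q powi (- int k * nstat n \<mu> + 3 * nstat_conj n \<mu>
          + vsize n \<mu> * (int k * (int n - 1) + 1)) =
        (\<Prod>m<n. (-1) powi (v m - int (k * m)) *
          q powi (3 * tri (v m - int (k * m)) + (v m - int (k * m)) * (1 + int k * int m)))"
      unfolding weight_eq_prod[OF q] prod_atLeastAtMost_rev
      by (intro prod.cong refl) (simp add: v of_nat_diff)
    have 2: "prod_exc k 1
        (\<lambda>(i, j).
           qpoch_quot q (1 + int k * (int j - int i - 1) + \<mu> i - \<mu> j)
                        (int k * (int j - int i + 1) + \<mu> i - \<mu> j)
         * qpoch_quot q (1 + int k * (2 * int n - 1 - int i - int j) + \<mu> i + \<mu> j)
                        (int k * (2 * int n + 1 - int i - int j) + \<mu> i + \<mu> j))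
        (index_pairs n) =
      (\<Prod>m<n. ((q powi v m) ^ (2 * k - 1)) ^ m) * pair_prod q k n (\<lambda>m. usym q (v m))"
    proof -
      have "(\<Prod>m<n. \<Prod>l<m.
          qpoch_quot q (1 + int k * (int (n - l) - int (n - m) - 1) + \<mu> (n - m) - \<mu> (n - l))
                       (int k * (int (n - l) - int (n - m) + 1) + \<mu> (n - m) - \<mu> (n - l))
        * qpoch_quot q (1 + int k * (2 * int n - 1 - int (n - m) - int (n - l)) + \<mu> (n - m) + \<mu> (n - l))
                       (int k * (2 * int n + 1 - int (n - m) - int (n - l)) + \<mu> (n - m) + \<mu> (n - l))) =
        (\<Prod>m<n. \<Prod>l<m. (q powi v m) ^ (2 * k - 1) * pair_factor q k (usym q (v m)) (usym q (v l)))"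
      proof (intro prod.cong refl)
        fix m l assume ml: "m \<in> {..<n}" "l \<in> {..<m}"
        have "1 + int k * (int (n - l) - int (n - m) - 1) + \<mu> (n - m) - \<mu> (n - l) = v m - v l + 1 - int k"
          "int k * (int (n - l) - int (n - m) + 1) + \<mu> (n - m) - \<mu> (n - l) = v m - v l + int k"
          "1 + int k * (2 * int n - 1 - int (n - m) - int (n - l)) + \<mu> (n - m) + \<mu> (n - l) = v m + v l + 1 - int k"
          "int k * (2 * int n + 1 - int (n - m) - int (n - l)) + \<mu> (n - m) + \<mu> (n - l) = v m + v l + int k"
          using ml by (simp_all add: v of_nat_diff algebra_simps)
        then show "qpoch_quot q (1 + int k * (int (n - l) - int (n - m) - 1) + \<mu> (n - m) - \<mu> (n - l))
                       (int k * (int (n - l) - int (n - m) + 1) + \<mu> (n - m) - \<mu> (n - l))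
          * qpoch_quot q (1 + int k * (2 * int n - 1 - int (n - m) - int (n - l)) + \<mu> (n - m) + \<mu> (n - l))
                       (int k * (2 * int n + 1 - int (n - m) - int (n - l)) + \<mu> (n - m) + \<mu> (n - l)) =
          (q powi v m) ^ (2 * k - 1) * pair_factor q k (usym q (v m)) (usym q (v l))"
          by (simp only: qpoch_quot_pair[OF q k])
      qed
      then show ?thesis
        using False by (simp add: prod_exc_def prod_index_pairs prod.distrib pair_prod_def)
    qed
    have "h v = (\<Prod>m<n. (-1) powi (v m - int (k * m)) *
          q powi (3 * tri (v m - int (k * m)) + (v m - int (k * m)) * (1 + int k * int m)) *
          ((q powi v m) ^ (2 * k - 1)) ^ m) * pair_prod q k n (\<lambda>m. usym q (v m))"
      unfolding shifted_weight[OF q k] h_def C_def prod.distrib by (simp only: mult.assoc)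
    then show "h v = (-1) powi vsize n \<mu>
            * q powi (- int k * nstat n \<mu> + 3 * nstat_conj n \<mu>
                      + vsize n \<mu> * (int k * (int n - 1) + 1))
            * prod_exc k 1
                (\<lambda>(i, j).
                   qpoch_quot q (1 + int k * (int j - int i - 1) + \<mu> i - \<mu> j)
                                (int k * (int j - int i + 1) + \<mu> i - \<mu> j)
                 * qpoch_quot q (1 + int k * (2 * int n - 1 - int i - int j) + \<mu> i + \<mu> j)
                                (int k * (2 * int n + 1 - int i - int j) + \<mu> i + \<mu> j))
                (index_pairs n)"
      unfolding 1 2 by (simp only: prod.distrib mult.assoc)
  next
    fix v :: "nat \<Rightarrow> int" assume v: "v \<in> {..<n} \<rightarrow>\<^sub>E UNIV"
    define \<mu> where "\<mu> = restrict (\<lambda>i. v (n - i) - int (k * (n - i))) {1..n}"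
    show "restrict (\<lambda>m. \<mu> (n - m) + int (k * m)) {..<n} = v"
      using v by (auto simp: \<mu>_def PiE_iff extensional_def fun_eq_iff)
    show "\<mu> \<in> int_vecs n" by (simp add: \<mu>_def int_vecs_def)
  next
    show "qpoch_inf q q ^ n * prod_exc k 1
        (\<lambda>(i, j). qpoch_quot q (int k * (int j - int i)) (int k * (int j - int i + 1))) (index_pairs n) =
      C * (qpoch_inf q q ^ n * spread_limit p k n)"
      unfolding C[symmetric] by (simp only: mult_ac)
  next
    show "(h has_sum C * (qpoch_inf q q ^ n * spread_limit p k n)) ({..<n} \<rightarrow>\<^sub>E UNIV)" by (rule sum)
  qed
qed

end
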